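(* Weak refinement is a precongruence with respect to parallel composition of APECAs: for APECAs $\mathcal{E}_1,\mathcal{E}_1',\mathcal{E}_2$ such that the atomic propositions of $\mathcal{E}_2$ are disjoint from those of $\mathcal{E}_1$ and of $\mathcal{E}_1'$, if $\mathcal{E}_1\preceq_W\mathcal{E}_1'$ then $\mathcal{E}_1\parallel\mathcal{E}_2\preceq_W\mathcal{E}_1'\parallel\mathcal{E}_2$ and $\mathcal{E}_2\parallel\mathcal{E}_1\preceq_W\mathcal{E}_2\parallel\mathcal{E}_1'$.
   Context: Basics. $\mathit{Dist}(S)$: discrete probability distributions on $S$; $\mu_l$ is the point distribution on $l$. $\mathbb{B}_3=\{\bot,?,\top\}$ with $\bot<?<\top$ and meet $\sqcap$. Guards over a clock set are finite conjunctions of atoms $x\sim c$; $CC(X)$ is the set of guards. A probability constraint $\varphi$ over $S$ denotes $\mathit{Sat}(\varphi)\subseteq\mathit{Dist}(S)$; $PC(S)$ is the set of constraints. Regions and the region construction of timed automata are as usual. APECA. An APECA is $\mathcal{E}=(L,A,X_A,AP,V,T,l_0)$ with finite $L$, actions $A$, clocks $X_A=\{x_a:a\in A\}$, $V:L\to2^{2^{AP}}$, $T:L\times CC(X_A)\times A\times PC(L)\to\mathbb{B}_3$ (must-edges $T=\top$, may-edges $T=?$), such that for all $l,a$ the disjunction of guards $g$ with some $T(l,g,a,\varphi)\neq\bot$ is $\mathit{true}$. An $a$-edge resets exactly $x_a$. Region automaton and weak refinement. $\mathsf{R}(\mathcal{E})$ is the abstract probabilistic automaton with states $(l,\theta)$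 reachable from $(l_0,\overline0)$, labelling $V(l)$, and for each edge $l\rightsquigarrow^{g,a}\varphi$ and region $\theta''\subseteq g$ reachable from $\theta$ by time elapse, an edge of the same type labelled $(\theta'',a,\zeta)$ whose constraint's distributions assign $\mu(l')$ to $(l',\theta''[\{x_a\}:=0])$ for $\mu\in\mathit{Sat}(\varphi)$. For $R\subseteq S\times S'$, $\mu\Subset_R\mu'$ iff some $\delta:S\to(S'\to[0,1])$ has $\delta(s)\in\mathit{Dist}(S')$ when $\mu(s)>0$, $\mu'(s')=\sum_s\mu(s)\delta(s)(s')$, and $\delta(s)(s')>0\Rightarrow(s,s')\in R$. $R\subseteq S_1\times S_2$ is a weak refinement relation iff for $(s_1,s_2)\in R$: (1) every must-edge $s_2\xrightarrow{b}\varphi_2$ has a must-edge $s_1\xrightarrow{b}\varphi_1$ with each $\mu_1\in\mathit{Sat}(\varphi_1)$ satisfying $\mu_1\Subset_R\mu_2$ for some $\mu_2\in\mathit{Sat}(\varphi_2)$; (2) every edge $s_1\rightsquigarrow^{b}\varphi_1$ has $s_2\rightsquigarrow^{b}\varphi_2$ with the same property; (3) $V_1(s_1)\subseteq V_2(s_2)$. $\mathcal{E}\preceq_W\mathcal{E}'$ iff such a relation relates the initial states of $\mathsf{R}(\mathcal{E})$ and $\mathsf{R}(\mathcal{E}')$. Parallel composition. Before composing, action sets are equalized: for each action $a$ of one APECA missing in the other, $a$ is added to the other and every location $l$ of it gets a must-edge $T(l,\mathit{true},a,\varphi)=\top$ with $\mathit{Sat}(\varphi)=\{\mu_l\}$.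 For $\mathcal{E}_i=(L_i,A,X_A,AP_i,V_i,T_i,l_0^i)$ with $AP_1\cap AP_2=\emptyset$, $\mathcal{E}_1\parallel\mathcal{E}_2=(L_1\times L_2,A,X_A,AP_1\cup AP_2,V_\parallel,T_\parallel,\langle l_0^1,l_0^2\rangle)$ where $V_\parallel(\langle l_1,l_2\rangle)=\{E_1\cup E_2:E_1\in V_1(l_1),E_2\in V_2(l_2)\}$; whenever $T_1(l_1,g_1,a,\varphi_1)\neq\bot$ and $T_2(l_2,g_2,a,\varphi_2)\neq\bot$, $T_\parallel(\langle l_1,l_2\rangle,g_1\wedge g_2,a,\varphi_\parallel)=T_1(l_1,g_1,a,\varphi_1)\sqcap T_2(l_2,g_2,a,\varphi_2)$ with $\mu_\parallel\in\mathit{Sat}(\varphi_\parallel)$ iff there are $\mu_1\in\mathit{Sat}(\varphi_1)$, $\mu_2\in\mathit{Sat}(\varphi_2)$ with $\mu_\parallel(\langle k_1,k_2\rangle)=\mu_1(k_1)\mu_2(k_2)$ for all $k_1,k_2$; all other values are $\bot$. *)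

theory Defs
  imports "HOL-Probability.Probability"
begin

datatype b3 = Bot | May | Must

instantiation b3 :: linorder
begin

fun rank_b3 :: "b3 \<Rightarrow> nat" where
  "rank_b3 Bot = 0"
| "rank_b3 May = 1"
| "rank_b3 Must = 2"

definition less_eq_b3 :: "b3 \<Rightarrow> b3 \<Rightarrow> bool" where
  "x \<le> y \<longleftrightarrow> rank_b3 x \<le> rank_b3 y"

definition less_b3 :: "b3 \<Rightarrow> b3 \<Rightarrow> bool" where
  "x < y \<longleftrightarrow> rank_b3 x < rank_b3 y"

instance
proof
  fix x y :: b3
  show "x \<le> y \<Longrightarrow> y \<le> x \<Longrightarrow> x = y"
    by (cases x; cases y) (auto simp: less_eq_b3_def)
qed (auto simp: less_eq_b3_def less_b3_def)

end

instance b3 :: finite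
proof
  have "(UNIV :: b3 set) = {Bot, May, Must}"
    using b3.exhaust by blast
  then show "finite (UNIV :: b3 set)"
    by (metis finite.emptyI finite.insertI)
qed

text \<open>There is exactly one clock per action, so the clock \<open>x\<^sub>a\<close> is represented by the
  action \<open>a\<close> itself. A guard is a finite conjunction of atoms; the empty list is \<open>true\<close> and
  conjunction is concatenation.\<close>

datatype cmp = LT | LE | EQ | GE | GT

type_synonym 'a guard = "('a \<times> cmp \<times> nat) list"

type_synonym 'a valuation = "'a \<Rightarrow> real"

type_synonym 'a region = "'a valuation set"

fun cmp_sat :: "cmp \<Rightarrow> real \<Rightarrow> real \<Rightarrow> bool" where
  "cmp_sat LT r c \<longleftrightarrow> r < c"
| "cmp_sat LE r c \<longleftrightarrow> r \<le> c"
| "cmp_sat EQ r c \<longleftrightarrow> r = c"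
| "cmp_sat GE r c \<longleftrightarrow> r \<ge> c"
| "cmp_sat GT r c \<longleftrightarrow> r > c"

definition guards :: "'a set \<Rightarrow> 'a guard set" where
  "guards A = {g. \<forall>(x, r, c) \<in> set g. x \<in> A}"

definition guard_sat :: "'a valuation \<Rightarrow> 'a guard \<Rightarrow> bool" where
  "guard_sat v g \<longleftrightarrow> (\<forall>(x, r, c) \<in> set g. cmp_sat r (v x) (real c))"

definition valuations :: "'a set \<Rightarrow> 'a valuation set" where
  "valuations A = A \<rightarrow>\<^sub>E {0..}"

definition elapse :: "'a set \<Rightarrow> 'a valuation \<Rightarrow> real \<Rightarrow> 'a valuation" where
  "elapse A v d = (\<lambda>x\<in>A. v x + d)"

text \<open>Region equivalence is taken relative to a ceiling \<open>K x\<close> for every clock \<open>x\<close>. The value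
  \<open>\<infinity>\<close> only occurs for a clock that is compared to unboundedly many constants; for automata
  with finitely many edges this is the textbook region equivalence.\<close>

definition below :: "('a \<Rightarrow> enat) \<Rightarrow> 'a valuation \<Rightarrow> 'a \<Rightarrow> bool" where
  "below K v x \<longleftrightarrow> ereal (v x) \<le> ereal_of_enat (K x)"

definition region_equiv :: "('a \<Rightarrow> enat) \<Rightarrow> 'a set \<Rightarrow> 'a valuation \<Rightarrow> 'a valuation \<Rightarrow> bool" where
  "region_equiv K A u v \<longleftrightarrow>
     (\<forall>x\<in>A. below K u x \<longleftrightarrow> below K v x) \<and>
     (\<forall>x\<in>A. below K u x \<longrightarrow>
        \<lfloor>u x\<rfloor> = \<lfloor>v x\<rfloor> \<and> (frac (u x) = 0 \<longleftrightarrow> frac (v x) = 0)) \<and>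
     (\<forall>x\<in>A. \<forall>y\<in>A. below K u x \<and> below K u y \<longrightarrow>
        (frac (u x) \<le> frac (u y) \<longleftrightarrow> frac (v x) \<le> frac (v y)))"

definition region_of :: "('a \<Rightarrow> enat) \<Rightarrow> 'a set \<Rightarrow> 'a valuation \<Rightarrow> 'a region" where
  "region_of K A v = {u \<in> valuations A. region_equiv K A v u}"

definition regions :: "('a \<Rightarrow> enat) \<Rightarrow> 'a set \<Rightarrow> 'a region set" where
  "regions K A = region_of K A ` valuations A"

definition time_succ :: "'a set \<Rightarrow> 'a region \<Rightarrow> 'a region \<Rightarrow> bool" where
  "time_succ A \<theta> \<theta>' \<longleftrightarrow> (\<forall>v\<in>\<theta>. \<exists>d\<ge>0. elapse A v d \<in> \<theta>')"

definition region_reset :: "'a \<Rightarrow> 'a region \<Rightarrow> 'a region" where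
  "region_reset a \<theta> = (\<lambda>v. v(a := 0)) ` \<theta>"

text \<open>A probability constraint is represented by the set of distributions satisfying it.\<close>

type_synonym 's constraint = "'s pmf set"

definition constraints :: "'s set \<Rightarrow> 's constraint set" where
  "constraints S = {\<phi>. \<forall>\<mu>\<in>\<phi>. set_pmf \<mu> \<subseteq> S}"

record ('l, 'a, 'p) apeca =
  locs  :: "'l set"
  acts  :: "'a set"
  props :: "'p set"
  lab   :: "'l \<Rightarrow> 'p set set"
  edge  :: "'l \<Rightarrow> 'a guard \<Rightarrow> 'a \<Rightarrow> 'l constraint \<Rightarrow> b3"
  start :: "'l"

definition is_apeca :: "('l, 'a, 'p) apeca \<Rightarrow> bool" where
  "is_apeca E \<longleftrightarrow>
     finite (locs E) \<and> finite (acts E) \<and> start E \<in> locs E \<and>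
     (\<forall>l\<in>locs E. lab E l \<subseteq> Pow (props E)) \<and>
     (\<forall>l g a \<phi>. edge E l g a \<phi> \<noteq> Bot \<longrightarrow>
        l \<in> locs E \<and> g \<in> guards (acts E) \<and> a \<in> acts E \<and> \<phi> \<in> constraints (locs E)) \<and>
     (\<forall>l\<in>locs E. \<forall>a\<in>acts E. \<forall>v\<in>valuations (acts E).
        \<exists>g \<phi>. edge E l g a \<phi> \<noteq> Bot \<and> guard_sat v g)"

definition ceil_of :: "('l, 'a, 'p) apeca \<Rightarrow> 'a \<Rightarrow> enat" where
  "ceil_of E x = Sup {enat c | c l g a \<phi> r. edge E l g a \<phi> \<noteq> Bot \<and> (x, r, c) \<in> set g}"

record ('s, 'b, 'p) apa =
  states :: "'s set"
  slab   :: "'s \<Rightarrow> 'p set set"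
  strans :: "'s \<Rightarrow> 'b \<Rightarrow> 's constraint \<Rightarrow> b3"
  sinit  :: "'s"

definition dist_ref :: "'s set \<Rightarrow> 't set \<Rightarrow> ('s \<times> 't) set \<Rightarrow> 's pmf \<Rightarrow> 't pmf \<Rightarrow> bool" where
  "dist_ref S S' R \<mu> \<mu>' \<longleftrightarrow>
     (\<exists>\<delta> :: 's \<Rightarrow> 't \<Rightarrow> real.
        (\<forall>s\<in>S. \<forall>s'\<in>S'. 0 \<le> \<delta> s s' \<and> \<delta> s s' \<le> 1) \<and>
        (\<forall>s\<in>S. pmf \<mu> s > 0 \<longrightarrow> (\<delta> s has_sum 1) S') \<and>
        (\<forall>s'\<in>S'. pmf \<mu>' s' = (\<Sum>\<^sub>\<infinity>s\<in>S. pmf \<mu> s * \<delta> s s')) \<and>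
        (\<forall>s\<in>S. \<forall>s'\<in>S'. \<delta> s s' > 0 \<longrightarrow> (s, s') \<in> R))"

definition constraint_ref ::
  "'s set \<Rightarrow> 't set \<Rightarrow> ('s \<times> 't) set \<Rightarrow> 's constraint \<Rightarrow> 't constraint \<Rightarrow> bool" where
  "constraint_ref S S' R \<phi> \<phi>' \<longleftrightarrow> (\<forall>\<mu>\<in>\<phi>. \<exists>\<mu>'\<in>\<phi>'. dist_ref S S' R \<mu> \<mu>')"

definition weak_ref_rel ::
  "('s, 'b, 'p) apa \<Rightarrow> ('t, 'b, 'p) apa \<Rightarrow> ('s \<times> 't) set \<Rightarrow> bool" where
  "weak_ref_rel N1 N2 R \<longleftrightarrow>
     R \<subseteq> states N1 \<times> states N2 \<and>
     (\<forall>(s1, s2) \<in> R.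
        (\<forall>b \<phi>2. strans N2 s2 b \<phi>2 = Must \<longrightarrow>
           (\<exists>\<phi>1. strans N1 s1 b \<phi>1 = Must \<and>
              constraint_ref (states N1) (states N2) R \<phi>1 \<phi>2)) \<and>
        (\<forall>b \<phi>1. strans N1 s1 b \<phi>1 \<noteq> Bot \<longrightarrow>
           (\<exists>\<phi>2. strans N2 s2 b \<phi>2 \<noteq> Bot \<and>
              constraint_ref (states N1) (states N2) R \<phi>1 \<phi>2)) \<and>
        slab N1 s1 \<subseteq> slab N2 s2)"

text \<open>Edges with different guards may induce the same labelled edge of the region automaton;
  it is then a must-edge as soon as one of them is, whence the maximum. The set below is
  finite because \<open>b3\<close> is.\<close>

definition region_trans ::
  "('a \<Rightarrow> enat) \<Rightarrow> ('l, 'a, 'p) apeca \<Rightarrow> 'l \<times> 'a region \<Rightarrow> 'a region \<times> 'a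
    \<Rightarrow> ('l \<times> 'a region) constraint \<Rightarrow> b3" where
  "region_trans K E = (\<lambda>(l, \<theta>) (\<theta>'', a) \<zeta>.
     Max (insert Bot {edge E l g a \<phi> | g \<phi>.
       \<theta>'' \<in> regions K (acts E) \<and> time_succ (acts E) \<theta> \<theta>'' \<and>
       (\<forall>v\<in>\<theta>''. guard_sat v g) \<and>
       \<zeta> = map_pmf (\<lambda>l'. (l', region_reset a \<theta>'')) ` \<phi>}))"

definition region_init :: "('a \<Rightarrow> enat) \<Rightarrow> ('l, 'a, 'p) apeca \<Rightarrow> 'l \<times> 'a region" where
  "region_init K E = (start E, region_of K (acts E) (\<lambda>x\<in>acts E. 0))"

inductive_set region_reach ::
  "('a \<Rightarrow> enat) \<Rightarrow> ('l, 'a, 'p) apeca \<Rightarrow> ('l \<times> 'a region) set"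
  for K :: "'a \<Rightarrow> enat" and E :: "('l, 'a, 'p) apeca" where
  init: "region_init K E \<in> region_reach K E"
| step: "s \<in> region_reach K E \<Longrightarrow> region_trans K E s b \<zeta> \<noteq> Bot \<Longrightarrow> \<mu> \<in> \<zeta> \<Longrightarrow> s' \<in> set_pmf \<mu>
    \<Longrightarrow> s' \<in> region_reach K E"

definition region_automaton ::
  "('a \<Rightarrow> enat) \<Rightarrow> ('l, 'a, 'p) apeca \<Rightarrow> ('l \<times> 'a region, 'a region \<times> 'a, 'p) apa" where
  "region_automaton K E =
     \<lparr> states = region_reach K E,
       slab = (\<lambda>(l, \<theta>). lab E l),
       strans = region_trans K E,
       sinit = region_init K E \<rparr>"

text \<open>Edge labels of the two region automata are compared literally, so both are built over
  the same clocks and with the same ceilings: the least ones covering all constants of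
  both automata.\<close>

definition weak_refines ::
  "('l, 'a, 'p) apeca \<Rightarrow> ('m, 'a, 'p) apeca \<Rightarrow> bool" (infix "\<preceq>\<^sub>W" 50) where
  "E \<preceq>\<^sub>W E' \<longleftrightarrow> acts E = acts E' \<and>
     (let K = (\<lambda>x. max (ceil_of E x) (ceil_of E' x));
          N = region_automaton K E; N' = region_automaton K E'
      in \<exists>R. weak_ref_rel N N' R \<and> (sinit N, sinit N') \<in> R)"

definition equalize :: "'a set \<Rightarrow> ('l, 'a, 'p) apeca \<Rightarrow> ('l, 'a, 'p) apeca" where
  "equalize B E = E \<lparr> acts := acts E \<union> B,
     edge := (\<lambda>l g a \<phi>.
       if a \<in> B - acts E
       then (if l \<in> locs E \<and> g = [] \<and> \<phi> = {return_pmf l} then Must else Bot)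
       else edge E l g a \<phi>) \<rparr>"

definition prod_constraint :: "'l constraint \<Rightarrow> 'm constraint \<Rightarrow> ('l \<times> 'm) constraint" where
  "prod_constraint \<phi>1 \<phi>2 =
     {\<mu>. \<exists>\<mu>1\<in>\<phi>1. \<exists>\<mu>2\<in>\<phi>2. \<forall>k1 k2. pmf \<mu> (k1, k2) = pmf \<mu>1 k1 * pmf \<mu>2 k2}"

text \<open>Composition over a common action set. The meet on \<open>b3\<close> is \<open>min\<close>. Different pairs of
  edges may have the same conjoined guard and the same product constraint; the composed edge
  is then a must-edge as soon as one of these pairs yields one.\<close>

definition par_eq ::
  "('l, 'a, 'p) apeca \<Rightarrow> ('m, 'a, 'p) apeca \<Rightarrow> ('l \<times> 'm, 'a, 'p) apeca" where
  "par_eq E1 E2 =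
     \<lparr> locs = locs E1 \<times> locs E2,
       acts = acts E1,
       props = props E1 \<union> props E2,
       lab = (\<lambda>(l1, l2). {P1 \<union> P2 | P1 P2. P1 \<in> lab E1 l1 \<and> P2 \<in> lab E2 l2}),
       edge = (\<lambda>(l1, l2) g a \<phi>.
         Max (insert Bot {min (edge E1 l1 g1 a \<phi>1) (edge E2 l2 g2 a \<phi>2) | g1 g2 \<phi>1 \<phi>2.
           g = g1 @ g2 \<and> \<phi> = prod_constraint \<phi>1 \<phi>2 \<and>
           edge E1 l1 g1 a \<phi>1 \<noteq> Bot \<and> edge E2 l2 g2 a \<phi>2 \<noteq> Bot})),
       start = (start E1, start E2) \<rparr>"

definition par ::
  "('l, 'a, 'p) apeca \<Rightarrow> ('m, 'a, 'p) apeca \<Rightarrow> ('l \<times> 'm, 'a, 'p) apeca" (infixl "\<parallel>" 65) where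
  "E1 \<parallel> E2 = par_eq (equalize (acts E2) E1) (equalize (acts E1) E2)"

end

theory Submission
  imports Defs
begin

text \<open>Let \<open>R\<close> witness the refinement of \<open>E1'\<close> by \<open>E1\<close>. Two states of the composed region automata
  are related if they agree on the region \<open>\<theta>\<close> and on the location of \<open>E2\<close>, and if \<open>R\<close> relates the
  locations of \<open>E1\<close> and \<open>E1'\<close> at some region \<open>\<theta>0\<close> from which the projection of \<open>\<theta>\<close> to the clocks
  of \<open>E1\<close> is reached by letting time pass. The delay is needed because actions of \<open>E2\<close> alone let
  time pass without moving \<open>E1\<close>.

  The composition has more clocks and larger ceilings, so each of its regions projects into a single
  region of the component automata. Since region equivalence is a time-abstract bisimulation, a
  time successor in the composition projects to one in the component, and guards of the component
  do not distinguish the two. Matching distributions are coupled, and the product of a coupling with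
  the identity coupling of the distribution chosen by \<open>E2\<close> couples the product distributions.\<close>

section \<open>Distribution refinement as coupling\<close>

text \<open>The pmf library sums with \<open>infsetsum\<close>, while \<open>dist_ref\<close> uses
  \<open>has_sum\<close>. Absolute summability of \<open>pmf p\<close> makes the two notions
  agree.\<close>

lemma has_sum_pmf: "(pmf p has_sum measure_pmf.prob p A) A"
proof -
  have "Infinite_Set_Sum.abs_summable_on (pmf p) A"
    by (rule pmf_abs_summable)
  then show ?thesis
    by (metis abs_summable_equivalent abs_summable_summable has_sum_infsum infsetsum_infsum
        measure_pmf_conv_infsetsum)
qed

lemma has_sum_pmf_fst: "((\<lambda>y. pmf p (x, y)) has_sum pmf (map_pmf fst p) x) UNIV"
proof -
  have "bij_betw (Pair x) UNIV (fst -` {x})"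
    by (auto simp: bij_betw_def inj_on_def image_def)
  then have "((\<lambda>y. pmf p (x, y)) has_sum measure_pmf.prob p (fst -` {x})) UNIV"
    by (subst has_sum_reindex_bij_betw) (auto intro: has_sum_pmf)
  then show ?thesis
    by (simp add: pmf_map)
qed

lemma has_sum_pmf_snd: "((\<lambda>x. pmf p (x, y)) has_sum pmf (map_pmf snd p) y) UNIV"
proof -
  have "bij_betw (\<lambda>x. (x, y)) UNIV (snd -` {y})"
    by (auto simp: bij_betw_def inj_on_def image_def)
  then have "((\<lambda>x. pmf p (x, y)) has_sum measure_pmf.prob p (snd -` {y})) UNIV"
    by (subst has_sum_reindex_bij_betw) (auto intro: has_sum_pmf)
  then show ?thesis
    by (simp add: pmf_map)
qed

lemma pmf_bind_infsum:
  "pmf (bind_pmf p f) y = (\<Sum>\<^sub>\<infinity>x. pmf p x * pmf (f x) y)"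
proof -
  have "Infinite_Set_Sum.abs_summable_on (\<lambda>x. pmf p x * pmf (f x) y) UNIV"
    by (rule abs_summable_on_comparison_test'[OF pmf_abs_summable[of p]])
      (auto simp: abs_mult pmf_le_1 mult_left_le)
  then have "infsetsum (\<lambda>x. pmf p x * pmf (f x) y) UNIV = (\<Sum>\<^sub>\<infinity>x. pmf p x * pmf (f x) y)"
    by (rule infsetsum_infsum)
  then show ?thesis
    by (simp add: pmf_bind pmf_expectation_eq_infsetsum)
qed

text \<open>Extended by zero outside \<open>S\<close>, the function is nonnegative with total mass
  1. This turns the rows \<open>\<delta> s\<close> of a refinement into distributions.\<close>

lemma ex_pmf_of_has_sum:
  fixes f :: "'a \<Rightarrow> real"
  assumes "\<And>x. x \<in> S \<Longrightarrow> 0 \<le> f x" and "(f has_sum 1) S"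
  shows "\<exists>p. set_pmf p \<subseteq> S \<and> (\<forall>x\<in>S. pmf p x = f x)"
proof -
  define g where "g x = (if x \<in> S then f x else 0)" for x
  have sum: "(g has_sum 1) UNIV"
    using assms(2) by (subst has_sum_cong_neutral[where T = S and g = f]) (auto simp: g_def)
  have nonneg: "0 \<le> g x" for x
    using assms(1) by (auto simp: g_def)
  have "g summable_on UNIV"
    using sum by (auto simp: summable_on_def)
  then have abs: "Infinite_Set_Sum.abs_summable_on g UNIV"
    using nonneg by (simp flip: abs_summable_equivalent)
  have "infsetsum g UNIV = 1"
    using infsetsum_infsum[OF abs] infsumI[OF sum] by simp
  then have "(\<integral>\<^sup>+x. ennreal (g x) \<partial>count_space UNIV) = 1"
    using nn_integral_conv_infsetsum[OF abs] nonneg by simp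
  then have "pmf (embed_pmf g) x = g x" for x
    by (intro pmf_embed_pmf nonneg)
  then show ?thesis
    by (intro exI[of _ "embed_pmf g"]) (auto simp: set_pmf_eq g_def)
qed

text \<open>The rows of \<open>\<delta>\<close> form a kernel. Drawing \<open>s\<close> from
  \<open>\<mu>\<close> and then \<open>s'\<close> from row \<open>s\<close> gives a coupling
  supported in \<open>R\<close>.\<close>

lemma dist_ref_imp_rel_pmf:
  assumes ref: "dist_ref S S' R \<mu> \<mu>'" and S: "set_pmf \<mu> \<subseteq> S" and S': "set_pmf \<mu>' \<subseteq> S'"
  shows "rel_pmf (\<lambda>s s'. (s, s') \<in> R) \<mu> \<mu>'"
proof -
  obtain \<delta> where \<delta>: "\<And>s s'. s \<in> S \<Longrightarrow> s' \<in> S' \<Longrightarrow> 0 \<le> \<delta> s s'"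
      "\<And>s. s \<in> S \<Longrightarrow> pmf \<mu> s > 0 \<Longrightarrow> (\<delta> s has_sum 1) S'"
      "\<And>s'. s' \<in> S' \<Longrightarrow> pmf \<mu>' s' = (\<Sum>\<^sub>\<infinity>s\<in>S. pmf \<mu> s * \<delta> s s')"
      "\<And>s s'. s \<in> S \<Longrightarrow> s' \<in> S' \<Longrightarrow> \<delta> s s' > 0 \<Longrightarrow> (s, s') \<in> R"
    using ref unfolding dist_ref_def by blast
  \<comment> \<open>A row is known to have mass 1 only where \<open>\<mu>\<close> is positive, so
    the kernel is specified on the support; elsewhere the factor \<open>pmf \<mu> s\<close>
    vanishes.\<close>
  have "\<exists>p. set_pmf p \<subseteq> S' \<and> (\<forall>s'\<in>S'. pmf p s' = \<delta> s s')" if "s \<in> set_pmf \<mu>" for s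
    using \<delta>(1,2) S that by (intro ex_pmf_of_has_sum) (auto simp: set_pmf_eq pmf_pos)
  then obtain \<kappa> where \<kappa>: "\<And>s. s \<in> set_pmf \<mu> \<Longrightarrow> set_pmf (\<kappa> s) \<subseteq> S'"
      "\<And>s s'. s \<in> set_pmf \<mu> \<Longrightarrow> s' \<in> S' \<Longrightarrow> pmf (\<kappa> s) s' = \<delta> s s'"
    by metis
  have bind: "bind_pmf \<mu> \<kappa> = \<mu>'"
  proof (rule pmf_eqI)
    fix s'
    show "pmf (bind_pmf \<mu> \<kappa>) s' = pmf \<mu>' s'"
    proof (cases "s' \<in> S'")
      case True
      have "(\<Sum>\<^sub>\<infinity>s. pmf \<mu> s * pmf (\<kappa> s) s') = (\<Sum>\<^sub>\<infinity>s\<in>S. pmf \<mu> s * \<delta> s s')"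
        using S True \<kappa>(2) by (intro infsum_cong_neutral) (auto simp: set_pmf_eq)
      then show ?thesis
        using True by (simp add: pmf_bind_infsum \<delta>(3))
    next
      case False
      then have "s' \<notin> set_pmf (bind_pmf \<mu> \<kappa>)" "s' \<notin> set_pmf \<mu>'"
        using \<kappa>(1) S' by auto
      then show ?thesis
        by (simp add: set_pmf_eq)
    qed
  qed
  show ?thesis
  proof (rule rel_pmf.intros)
    let ?pq = "bind_pmf \<mu> (\<lambda>s. map_pmf (Pair s) (\<kappa> s))"
    show "map_pmf fst ?pq = \<mu>"
      by (simp add: map_bind_pmf map_pmf_comp bind_return_pmf')
    show "map_pmf snd ?pq = \<mu>'"
      by (simp add: map_bind_pmf map_pmf_comp bind)
    fix s s' assume "(s, s') \<in> set_pmf ?pq"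
    then have *: "s \<in> set_pmf \<mu>" "s' \<in> set_pmf (\<kappa> s)"
      by auto
    then have "s' \<in> S'" "\<delta> s s' > 0"
      using \<kappa>[OF *(1)] by (auto simp: pmf_positive subset_iff simp flip: \<kappa>(2))
    then show "(s, s') \<in> R"
      using \<delta>(4) * S by auto
  qed
qed

text \<open>A coupling yields a suitable \<open>\<delta>\<close> as the conditional distribution of
  its second coordinate given the first.\<close>

lemma rel_pmf_imp_dist_ref:
  assumes rel: "rel_pmf (\<lambda>s s'. (s, s') \<in> R) \<mu> \<mu>'"
    and S: "set_pmf \<mu> \<subseteq> S" and S': "set_pmf \<mu>' \<subseteq> S'"
  shows "dist_ref S S' R \<mu> \<mu>'"
proof -
  obtain pq where pq: "\<And>s s'. (s, s') \<in> set_pmf pq \<Longrightarrow> (s, s') \<in> R"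
      "map_pmf fst pq = \<mu>" "map_pmf snd pq = \<mu>'"
    using rel by (cases rule: rel_pmf.cases) blast
  \<comment> \<open>Where \<open>pmf \<mu> s = 0\<close> the quotient is 0 by convention;
    \<open>pq\<close> has no mass there either, so \<open>cancel\<close> holds for all
    \<open>s\<close>.\<close>
  define \<delta> where "\<delta> s s' = pmf pq (s, s') / pmf \<mu> s" for s s'
  have fst_sum: "((\<lambda>s'. pmf pq (s, s')) has_sum pmf \<mu> s) UNIV" for s
    using has_sum_pmf_fst[of pq s] by (simp add: pq)
  have snd_sum: "((\<lambda>s. pmf pq (s, s')) has_sum pmf \<mu>' s') UNIV" for s'
    using has_sum_pmf_snd[of pq s'] by (simp add: pq)
  have zero: "pmf pq (s, s') = 0" if "s \<notin> set_pmf \<mu> \<or> s' \<notin> set_pmf \<mu>'" for s s'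
    using that pq(2,3) by (metis fst_conv snd_conv imageI pmf.set_map pmf_eq_0_set_pmf)
  have le: "pmf pq (s, s') \<le> pmf \<mu> s" for s s'
  proof -
    have "measure_pmf.prob pq {(s, s')} \<le> measure_pmf.prob pq (fst -` {s})"
      by (intro measure_pmf.finite_measure_mono) auto
    then show ?thesis
      by (simp add: measure_pmf_single pmf_map flip: pq(2))
  qed
  have cancel: "pmf \<mu> s * \<delta> s s' = pmf pq (s, s')" for s s'
    using zero[of s s'] by (cases "pmf \<mu> s = 0") (auto simp: \<delta>_def set_pmf_eq)
  have \<delta>_le: "0 \<le> \<delta> s s' \<and> \<delta> s s' \<le> 1" for s s'
    unfolding \<delta>_def using le[of s s'] by (simp add: divide_le_eq_1 less_le)
  moreover have "(\<delta> s has_sum 1) S'" if "pmf \<mu> s > 0" for s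
  proof -
    have "((\<lambda>s'. pmf pq (s, s') * inverse (pmf \<mu> s)) has_sum pmf \<mu> s * inverse (pmf \<mu> s)) UNIV"
      by (rule has_sum_cmult_left[OF fst_sum])
    then have "(\<delta> s has_sum 1) UNIV"
      using that by (simp add: \<delta>_def[abs_def] divide_inverse)
    then show ?thesis
      using zero S' by (subst has_sum_cong_neutral[where T = UNIV and g = "\<delta> s"])
        (auto simp: \<delta>_def)
  qed
  moreover have "pmf \<mu>' s' = (\<Sum>\<^sub>\<infinity>s\<in>S. pmf \<mu> s * \<delta> s s')" for s'
  proof -
    have "(\<Sum>\<^sub>\<infinity>s\<in>S. pmf \<mu> s * \<delta> s s') = (\<Sum>\<^sub>\<infinity>s. pmf pq (s, s'))"
      using zero S by (intro infsum_cong_neutral) (auto simp: cancel)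
    then show ?thesis
      using infsumI[OF snd_sum] by simp
  qed
  moreover have "(s, s') \<in> R" if "\<delta> s s' > 0" for s s'
    using that by (intro pq(1)) (auto simp: \<delta>_def set_pmf_eq)
  ultimately show ?thesis
    unfolding dist_ref_def by (intro exI[of _ \<delta>]) auto
qed

lemma prod_constraint_eq:
  "prod_constraint \<phi> \<psi> = (\<lambda>(\<mu>, \<nu>). pair_pmf \<mu> \<nu>) ` (\<phi> \<times> \<psi>)"
proof -
  have "(\<forall>k1 k2. pmf \<rho> (k1, k2) = pmf \<mu> k1 * pmf \<nu> k2) \<longleftrightarrow> \<rho> = pair_pmf \<mu> \<nu>"
    for \<rho> :: "('a \<times> 'b) pmf" and \<mu> \<nu>
    by (auto simp: pmf_pair intro!: pmf_eqI)
  then show ?thesis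
    by (force simp: prod_constraint_def)
qed

section \<open>Region equivalence\<close>

text \<open>The demand of region equivalence on a single clock below its ceiling, split off so that
  the arithmetic of delays is free of ceilings.\<close>

definition same_region :: "real \<Rightarrow> real \<Rightarrow> bool" where
  "same_region r s \<longleftrightarrow> \<lfloor>r\<rfloor> = \<lfloor>s\<rfloor> \<and> (frac r = 0 \<longleftrightarrow> frac s = 0)"

text \<open>The floor alone decides \<open>real n \<le> r\<close>; the converse comparison also
  needs to know whether \<open>r\<close> is an integer.\<close>

lemma same_region_le_nat:
  assumes "same_region r s"
  shows "r \<le> real n \<longleftrightarrow> s \<le> real n" "real n \<le> r \<longleftrightarrow> real n \<le> s"
proof -
  have le: "x \<le> real n \<longleftrightarrow> \<lfloor>x\<rfloor> < int n \<or> \<lfloor>x\<rfloor> = int n \<and> frac x = 0" for x :: real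
    unfolding frac_def by linarith
  have ge: "real n \<le> x \<longleftrightarrow> int n \<le> \<lfloor>x\<rfloor>" for x :: real
    by linarith
  show "r \<le> real n \<longleftrightarrow> s \<le> real n" "real n \<le> r \<longleftrightarrow> real n \<le> s"
    using assms unfolding same_region_def le ge by auto
qed

lemma below_cong:
  assumes "same_region (u x) (v x)"
  shows "below K u x \<longleftrightarrow> below K v x"
  using same_region_le_nat(1)[OF assms] by (cases "K x") (auto simp: below_def)

lemma below_mono:
  assumes "below K u x" "K x \<le> K' x"
  shows "below K' u x"
  using assms unfolding below_def by (meson ereal_of_enat_le_iff order_trans)

lemma region_equiv_iff:
  "region_equiv K A u v \<longleftrightarrow>
     (\<forall>x\<in>A. below K u x \<longleftrightarrow> below K v x) \<and>
     (\<forall>x\<in>A. below K u x \<longrightarrow> same_region (u x) (v x)) \<and>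
     (\<forall>x\<in>A. \<forall>y\<in>A. below K u x \<and> below K u y \<longrightarrow>
        (frac (u x) \<le> frac (u y) \<longleftrightarrow> frac (v x) \<le> frac (v y)))"
  by (auto simp: region_equiv_def same_region_def)

lemma region_equiv_refl: "region_equiv K A u u"
  by (simp add: region_equiv_def)

lemma region_equiv_sym: "region_equiv K A u v \<Longrightarrow> region_equiv K A v u"
  by (simp add: region_equiv_def)

lemma region_equiv_trans:
  assumes "region_equiv K A u v" "region_equiv K A v w"
  shows "region_equiv K A u w"
  using assms unfolding region_equiv_def by simp

lemma region_of_self: "v \<in> valuations A \<Longrightarrow> v \<in> region_of K A v"
  by (simp add: region_of_def region_equiv_refl)

lemma region_of_equiv:
  assumes "u \<in> region_of K A w" "v \<in> region_of K A w"
  shows "region_equiv K A u v"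
  using assms unfolding region_of_def
  by (blast intro: region_equiv_trans region_equiv_sym)

lemma valuations_restrict: "v \<in> valuations A \<Longrightarrow> B \<subseteq> A \<Longrightarrow> restrict v B \<in> valuations B"
  by (auto simp: valuations_def)

lemma valuations_elapse: "v \<in> valuations A \<Longrightarrow> 0 \<le> d \<Longrightarrow> elapse A v d \<in> valuations A"
  by (auto simp: valuations_def elapse_def PiE_iff)

lemma valuations_reset: "v \<in> valuations A \<Longrightarrow> a \<in> A \<Longrightarrow> v(a := 0) \<in> valuations A"
  by (auto simp: valuations_def PiE_iff extensional_def)

text \<open>A clock below the smaller ceiling is below the larger one, where the finer equivalence
  controls it; a clock above the larger ceiling is above the smaller one in both valuations. Hence a
  composed region projects into a single component region.\<close>

lemma region_equiv_coarsen:
  assumes equiv: "region_equiv K' A u v" and "B \<subseteq> A" and le: "\<And>x. x \<in> B \<Longrightarrow> K x \<le> K' x"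
  shows "region_equiv K B (restrict u B) (restrict v B)"
proof -
  have restr: "below K (restrict w B) x \<longleftrightarrow> below K w x" if "x \<in> B" for w :: "'a \<Rightarrow> real" and x
    using that by (simp add: below_def)
  have up: "below K' w x" if "x \<in> B" "below K w x" for w x
    using that le below_mono by metis
  have same: "same_region (u x) (v x)" if "x \<in> B" "below K' u x" for x
    using that assms(2) equiv by (auto simp: region_equiv_iff)
  have b: "below K u x \<longleftrightarrow> below K v x" if "x \<in> B" for x
  proof (cases "below K' u x")
    case True
    show ?thesis
      by (rule below_cong) (rule same[OF that True])
  next
    case False
    then have "\<not> below K' v x"
      using that assms(2) equiv by (auto simp: region_equiv_iff)
    then show ?thesis
      using False up[OF that] by blast
  qed
  show ?thesis
    unfolding region_equiv_iff
  proof (intro conjI ballI impI)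
    fix x assume x: "x \<in> B"
    show "below K (restrict u B) x \<longleftrightarrow> below K (restrict v B) x"
      using x b by (simp add: restr)
    show "same_region (restrict u B x) (restrict v B x)" if "below K (restrict u B) x"
      using that x same up by (simp add: restr)
  next
    fix x y assume xy: "x \<in> B" "y \<in> B"
      and "below K (restrict u B) x \<and> below K (restrict u B) y"
    then have "below K' u x" "below K' u y"
      using up by (auto simp: restr)
    then show "frac (restrict u B x) \<le> frac (restrict u B y) \<longleftrightarrow>
        frac (restrict v B x) \<le> frac (restrict v B y)"
      using xy assms(2) equiv by (simp add: region_equiv_iff subset_iff)
  qed
qed

text \<open>The value 0 lies below every ceiling and has the least fractional part. Comparing
  another fraction with it only asks whether that fraction is zero, which \<open>same_region\<close>
  records.\<close>

lemma region_equiv_reset: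
  assumes "region_equiv K A u v"
  shows "region_equiv K A (u(a := 0)) (v(a := 0))"
proof -
  have upd: "below K (w(a := 0)) x \<longleftrightarrow> x = a \<or> below K w x" for w :: "'a \<Rightarrow> real" and x
    by (cases "K x") (auto simp: below_def)
  have frac0: "frac r \<le> 0 \<longleftrightarrow> frac r = 0" for r :: real
    using frac_ge_0[of r] by linarith
  show ?thesis
    using assms unfolding region_equiv_iff same_region_def upd
    by (auto simp: frac0)
qed

lemma cmp_sat_cong:
  assumes "same_region r s"
  shows "cmp_sat c r (real n) \<longleftrightarrow> cmp_sat c s (real n)"
  using same_region_le_nat[OF assms, of n] by (cases c) auto

text \<open>Below the ceiling, \<open>same_region\<close> fixes the comparison. Above it, both
  values exceed every constant compared with that clock, so the comparison operator alone
  decides.\<close>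

lemma region_equiv_guard_sat:
  assumes equiv: "region_equiv K A u v" and g: "g \<in> guards A"
    and le: "\<And>x r c. (x, r, c) \<in> set g \<Longrightarrow> enat c \<le> K x" and sat: "guard_sat u g"
  shows "guard_sat v g"
  unfolding guard_sat_def
proof safe
  fix x r c assume x: "(x, r, c) \<in> set g"
  then have A: "x \<in> A" and u: "cmp_sat r (u x) (real c)"
    using g sat by (auto simp: guards_def guard_sat_def)
  show "cmp_sat r (v x) (real c)"
  proof (cases "below K u x")
    case True
    then show ?thesis
      using u A equiv cmp_sat_cong by (auto simp: region_equiv_iff)
  next
    case False
    then have "\<not> below K v x"
      using A equiv by (auto simp: region_equiv_iff)
    have "real c < w x" if "\<not> below K w x" for w :: "'a \<Rightarrow> real"
      using that le[OF x] by (cases "K x") (auto simp: below_def)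
    then have "real c < u x" "real c < v x"
      using False \<open>\<not> below K v x\<close> by auto
    then show ?thesis
      using u by (cases r) auto
  qed
qed

lemma guard_sat_restrict:
  "g \<in> guards A \<Longrightarrow> guard_sat (restrict v A) g \<longleftrightarrow> guard_sat v g"
  by (force simp: guards_def guard_sat_def)

section \<open>Time elapse respects region equivalence\<close>

text \<open>Since \<open>f\<close> and \<open>h\<close> order the finite set \<open>B\<close> alike,
  a cut \<open>s\<close> of the values of \<open>f\<close> can be copied to \<open>h\<close>: at the
  corresponding value if \<open>s\<close> is attained, and otherwise, by density, between the two
  groups it separates.\<close>

lemma frac_threshold:
  fixes f h :: "'a \<Rightarrow> real"
  assumes fin: "finite B" and f: "\<And>x. x \<in> B \<Longrightarrow> 0 \<le> f x" and h: "\<And>x. x \<in> B \<Longrightarrow> 0 \<le> h x \<and> h x < 1"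
    and zero: "\<And>x. x \<in> B \<Longrightarrow> f x = 0 \<longleftrightarrow> h x = 0"
    and ord: "\<And>x y. x \<in> B \<Longrightarrow> y \<in> B \<Longrightarrow> f x \<le> f y \<longleftrightarrow> h x \<le> h y"
    and s: "0 < s"
  shows "\<exists>s'. 0 < s' \<and> s' < 1 \<and>
    (\<forall>x\<in>B. (f x < s \<longleftrightarrow> h x < s') \<and> (f x = s \<longleftrightarrow> h x = s'))"
proof (cases "\<exists>y\<in>B. f y = s")
  case True
  then obtain y where y: "y \<in> B" "f y = s"
    by blast
  have "0 < h y"
    using zero[OF y(1)] h[OF y(1)] y(2) s by auto
  moreover have "(f x < s \<longleftrightarrow> h x < h y) \<and> (f x = s \<longleftrightarrow> h x = h y)" if "x \<in> B" for x
    using ord[OF that y(1)] ord[OF y(1) that] y(2) by auto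
  ultimately show ?thesis
    using h[OF y(1)] by (intro exI[of _ "h y"]) auto
next
  case False
  \<comment> \<open>Inserting 0 into \<open>L\<close> and 1 into \<open>H\<close> keeps both sets
    nonempty and forces \<open>s'\<close> into the open unit interval.\<close>
  define L where "L = insert 0 (h ` {x \<in> B. f x < s})"
  define H where "H = insert 1 (h ` {x \<in> B. s < f x})"
  have "finite L" "L \<noteq> {}" "finite H" "H \<noteq> {}"
    using fin by (auto simp: L_def H_def)
  note LH = this
  have "h x < h y" if "x \<in> B" "y \<in> B" "f x < s" "s < f y" for x y
    using that ord[of y x] by auto
  moreover have "0 < h y" if "y \<in> B" "s < f y" for y
    using that h[of y] zero[of y] s by (auto simp: less_le)
  ultimately have "\<forall>x\<in>L. \<forall>y\<in>H. x < y"
    using h by (auto simp: L_def H_def)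
  then have "Max L < Min H"
    using LH by (simp add: Max_less_iff Min_gr_iff)
  then obtain s' where s': "Max L < s'" "s' < Min H"
    using dense by blast
  then have L: "\<And>x. x \<in> L \<Longrightarrow> x < s'" and H: "\<And>x. x \<in> H \<Longrightarrow> s' < x"
    using LH by auto
  have "(f x < s \<longleftrightarrow> h x < s') \<and> (f x = s \<longleftrightarrow> h x = s')" if "x \<in> B" for x
  proof (cases "f x < s")
    case True
    then have "h x < s'" using that by (intro L) (auto simp: L_def)
    then show ?thesis using True by auto
  next
    case ge: False
    then have "s < f x" using False that by force
    then have "s' < h x" using that by (intro H) (auto simp: H_def)
    then show ?thesis using \<open>s < f x\<close> by auto
  qed
  moreover have "0 < s'" "s' < 1"
    using L[of 0] H[of 1] by (auto simp: L_def H_def)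
  ultimately show ?thesis
    by blast
qed

lemma floor_frac_add:
  fixes r e :: real
  assumes "0 \<le> e" "e < 1"
  shows "\<lfloor>r + (of_int n + e)\<rfloor> = \<lfloor>r\<rfloor> + n + (if frac r + e < 1 then 0 else 1)"
    "frac (r + (of_int n + e)) = frac r + e - (if frac r + e < 1 then 0 else 1)"
proof -
  show *: "\<lfloor>r + (of_int n + e)\<rfloor> = \<lfloor>r\<rfloor> + n + (if frac r + e < 1 then 0 else 1)"
    using assms frac_lt_1[of r] frac_ge_0[of r] unfolding frac_def
    by (intro floor_unique; split if_split; linarith)
  show "frac (r + (of_int n + e)) = frac r + e - (if frac r + e < 1 then 0 else 1)"
    unfolding frac_def[of "r + _"] * by (auto simp: frac_def)
qed

text \<open>The answering delay keeps the integer part of \<open>d\<close>. Its fractional part is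
  chosen so that the same clocks stay below the next integer and the same clocks hit it exactly,
  which together with the old order of fractions determines the new data.\<close>

lemma same_region_elapse:
  fixes u v :: "'a \<Rightarrow> real"
  assumes fin: "finite B" and same: "\<And>x. x \<in> B \<Longrightarrow> same_region (u x) (v x)"
    and ord: "\<And>x y. x \<in> B \<Longrightarrow> y \<in> B \<Longrightarrow> frac (u x) \<le> frac (u y) \<longleftrightarrow> frac (v x) \<le> frac (v y)"
    and d: "0 \<le> d"
  shows "\<exists>d'\<ge>0. (\<forall>x\<in>B. same_region (u x + d) (v x + d')) \<and>
    (\<forall>x\<in>B. \<forall>y\<in>B. frac (u x + d) \<le> frac (u y + d) \<longleftrightarrow> frac (v x + d') \<le> frac (v y + d'))"
proof -
  obtain n e where e: "0 \<le> e" "e < 1" and d_eq: "d = of_int n + e" and n: "0 \<le> n"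
  proof
    show "d = of_int \<lfloor>d\<rfloor> + frac d" "0 \<le> \<lfloor>d\<rfloor>"
      using d by (simp_all add: frac_def)
  qed (auto simp: frac_lt_1)
  obtain e' where e': "0 \<le> e'" "e' < 1" "e' = 0 \<longleftrightarrow> e = 0"
    "\<And>x. x \<in> B \<Longrightarrow> frac (u x) + e < 1 \<longleftrightarrow> frac (v x) + e' < 1"
    "\<And>x. x \<in> B \<Longrightarrow> frac (u x) + e = 1 \<longleftrightarrow> frac (v x) + e' = 1"
  \<comment> \<open>The case \<open>e = 0\<close> is separate because \<open>frac_threshold\<close>
    gives \<open>s' < 1\<close> and would make \<open>e'\<close> positive.\<close>
  proof (cases "e = 0")
    case True
    then show ?thesis
      by (intro that[of 0]) (auto simp: frac_lt_1 less_imp_neq)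
  next
    case False
    \<comment> \<open>A clock stays below the next integer iff its fraction is less than
      \<open>1 - e\<close>; this threshold is copied to \<open>v\<close>, and then
      \<open>e' = 1 - s'\<close>.\<close>
    have "\<exists>s'. 0 < s' \<and> s' < 1 \<and>
      (\<forall>x\<in>B. (frac (u x) < 1 - e \<longleftrightarrow> frac (v x) < s') \<and> (frac (u x) = 1 - e \<longleftrightarrow> frac (v x) = s'))"
      using same e by (intro frac_threshold fin ord) (auto simp: same_region_def frac_lt_1)
    then obtain s' where "0 < s'" "s' < 1" and s': "\<And>x. x \<in> B \<Longrightarrow>
        (frac (u x) < 1 - e \<longleftrightarrow> frac (v x) < s') \<and> (frac (u x) = 1 - e \<longleftrightarrow> frac (v x) = s')"
      by blast
    then show ?thesis
      using False by (intro that[of "1 - s'"]) (auto simp: algebra_simps)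
  qed
  define d' where "d' = of_int n + e'"
  have "0 \<le> d'"
    using n e'(1) by (simp add: d'_def)
  moreover have "same_region (u x + d) (v x + d')" if "x \<in> B" for x
    using same[OF that] e'(3) e'(4,5)[OF that] frac_ge_0[of "u x"] frac_ge_0[of "v x"] e(1) e'(1)
    unfolding same_region_def d'_def d_eq floor_frac_add[OF e] floor_frac_add[OF e'(1,2)]
    by (cases "frac (u x) + e < 1") (simp_all add: add_nonneg_eq_0_iff)
  moreover have "frac (u x + d) \<le> frac (u y + d) \<longleftrightarrow> frac (v x + d') \<le> frac (v y + d')"
    if "x \<in> B" "y \<in> B" for x y
    using ord[OF that] e'(4)[OF that(1)] e'(4)[OF that(2)]
      frac_ge_0[of "u x"] frac_ge_0[of "v x"] frac_ge_0[of "u y"] frac_ge_0[of "v y"]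
      frac_lt_1[of "u x"] frac_lt_1[of "v x"] frac_lt_1[of "u y"] frac_lt_1[of "v y"]
    unfolding d'_def d_eq floor_frac_add[OF e] floor_frac_add[OF e'(1,2)]
    by (cases "frac (u x) + e < 1"; cases "frac (u y) + e < 1"; simp; linarith?)
  ultimately show ?thesis
    by blast
qed

text \<open>Only clocks below their ceilings need exact tracking, and these are the same for
  \<open>u\<close> and \<open>v\<close>. A clock above its ceiling stays above as time
  passes.\<close>

lemma region_equiv_elapse:
  assumes fin: "finite A" and equiv: "region_equiv K A u v" and d: "0 \<le> d"
  shows "\<exists>d'\<ge>0. region_equiv K A (elapse A u d) (elapse A v d')"
proof -
  define B where "B = {x \<in> A. below K u x}"
  have "finite B" using fin by (simp add: B_def)
  moreover have "\<And>x. x \<in> B \<Longrightarrow> same_region (u x) (v x)"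
    "\<And>x y. x \<in> B \<Longrightarrow> y \<in> B \<Longrightarrow> frac (u x) \<le> frac (u y) \<longleftrightarrow> frac (v x) \<le> frac (v y)"
    using equiv by (auto simp: B_def region_equiv_iff)
  ultimately obtain d' where d': "0 \<le> d'" "\<And>x. x \<in> B \<Longrightarrow> same_region (u x + d) (v x + d')"
    "\<And>x y. x \<in> B \<Longrightarrow> y \<in> B \<Longrightarrow>
      frac (u x + d) \<le> frac (u y + d) \<longleftrightarrow> frac (v x + d') \<le> frac (v y + d')"
    using same_region_elapse[OF _ _ _ d, of B u v] by blast
  have mono: "below K w x" if "below K (elapse A w t) x" "0 \<le> t" "x \<in> A" for w t x
    using that unfolding below_def elapse_def
    by (cases "K x") auto
  have u: "x \<in> B" if "below K (elapse A u d) x" "x \<in> A" for x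
    using mono[OF that(1) d that(2)] that by (simp add: B_def)
  have v: "x \<in> B" if "below K (elapse A v d') x" "x \<in> A" for x
    using mono[OF that(1) d'(1) that(2)] that equiv by (simp add: B_def region_equiv_iff)
  have same: "same_region (elapse A u d x) (elapse A v d' x)" if "x \<in> B" for x
    using d'(2)[OF that] that by (simp add: elapse_def B_def)
  have "below K (elapse A u d) x \<longleftrightarrow> below K (elapse A v d') x" if "x \<in> A" for x
  proof (cases "x \<in> B")
    case True
    show ?thesis
      by (rule below_cong) (rule same[OF True])
  next
    case False
    then show ?thesis
      using u[OF _ that] v[OF _ that] by blast
  qed
  moreover have "frac (elapse A u d x) \<le> frac (elapse A u d y) \<longleftrightarrow>
      frac (elapse A v d' x) \<le> frac (elapse A v d' y)" if "x \<in> B" "y \<in> B" for x y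
    using d'(3)[OF that] that by (simp add: elapse_def B_def)
  ultimately have "region_equiv K A (elapse A u d) (elapse A v d')"
    unfolding region_equiv_iff using u same by blast
  with d'(1) show ?thesis
    by blast
qed

section \<open>Region automata and composition\<close>

lemma b3_le_Bot_iff [simp]: "t \<le> Bot \<longleftrightarrow> t = Bot"
  by (cases t) (auto simp: less_eq_b3_def)

lemma b3_Must_le_iff [simp]: "Must \<le> t \<longleftrightarrow> t = Must"
  by (cases t) (auto simp: less_eq_b3_def)

lemma b3_May_le_iff [simp]: "May \<le> t \<longleftrightarrow> t \<noteq> Bot"
  by (cases t) (auto simp: less_eq_b3_def)

text \<open>The thresholds \<open>t = Must\<close> and \<open>t = May\<close> express being a
  must-edge and being an edge. Facts of the form \<open>t \<le> ...\<close> treat both at once and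
  eliminate the maxima.\<close>

lemma le_Max_insert_Bot_iff:
  assumes "t \<noteq> Bot"
  shows "t \<le> Max (insert Bot X) \<longleftrightarrow> (\<exists>x\<in>X. t \<le> x)"
  using assms by (simp add: Max_ge_iff)

lemma le_region_trans_iff:
  assumes "t \<noteq> Bot"
  shows "t \<le> region_trans K E (l, \<theta>) (\<theta>'', a) \<zeta> \<longleftrightarrow>
    \<theta>'' \<in> regions K (acts E) \<and> time_succ (acts E) \<theta> \<theta>'' \<and>
    (\<exists>g \<phi>. t \<le> edge E l g a \<phi> \<and> (\<forall>v\<in>\<theta>''. guard_sat v g) \<and>
      \<zeta> = map_pmf (\<lambda>l'. (l', region_reset a \<theta>'')) ` \<phi>)"
  unfolding region_trans_def case_prod_conv le_Max_insert_Bot_iff[OF assms] by blast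

lemma le_region_transI:
  assumes "t \<noteq> Bot" "\<theta>'' \<in> regions K (acts E)" "time_succ (acts E) \<theta> \<theta>''" "t \<le> edge E l g a \<phi>"
    and "\<forall>v\<in>\<theta>''. guard_sat v g"
  shows "t \<le> region_trans K E (l, \<theta>) (\<theta>'', a) (map_pmf (\<lambda>l'. (l', region_reset a \<theta>'')) ` \<phi>)"
  using assms by (subst le_region_trans_iff) auto

lemma region_reach_set_pmf:
  assumes "s \<in> region_reach K E" "region_trans K E s b \<zeta> \<noteq> Bot" "\<mu> \<in> \<zeta>"
  shows "set_pmf \<mu> \<subseteq> region_reach K E"
  using assms region_reach.step by blast

text \<open>Well-formedness puts the targets of edges in \<open>locs E\<close>, so the last step of
  a run suffices. The fact matters because the loops added by \<open>equalize\<close> exist only at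
  such locations.\<close>

lemma region_reach_locs:
  assumes "is_apeca E" "(l, \<theta>) \<in> region_reach K E"
  shows "l \<in> locs E"
  using assms(2)
proof (cases rule: region_reach.cases)
  case init
  then show ?thesis
    using assms(1) by (simp add: region_init_def is_apeca_def)
next
  case (step s b \<zeta> \<mu>)
  obtain l0 \<theta>0 where s: "s = (l0, \<theta>0)"
    by (cases s)
  obtain \<theta>'' a where b: "b = (\<theta>'', a)"
    by (cases b)
  have "May \<le> region_trans K E (l0, \<theta>0) (\<theta>'', a) \<zeta>"
    using step s b by simp
  then obtain g \<phi> where e: "edge E l0 g a \<phi> \<noteq> Bot"
      and \<zeta>: "\<zeta> = map_pmf (\<lambda>l'. (l', region_reset a \<theta>'')) ` \<phi>"
    by (subst (asm) le_region_trans_iff) auto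
  have "\<phi> \<in> constraints (locs E)"
    using e assms(1) by (auto simp: is_apeca_def)
  then show ?thesis
    using step \<zeta> by (auto simp: constraints_def subset_iff)
qed

text \<open>Distributions on edges of reachable states live on reachable states, so the sums in
  \<open>dist_ref\<close> miss no mass and refinement becomes the existence of a coupling.\<close>

lemma constraint_ref_region_iff:
  assumes "s \<in> region_reach K E" "region_trans K E s b \<zeta> \<noteq> Bot"
    and "s' \<in> region_reach K' E'" "region_trans K' E' s' b' \<zeta>' \<noteq> Bot"
  shows "constraint_ref (region_reach K E) (region_reach K' E') R \<zeta> \<zeta>' \<longleftrightarrow>
    (\<forall>\<mu>\<in>\<zeta>. \<exists>\<mu>'\<in>\<zeta>'. rel_pmf (\<lambda>s s'. (s, s') \<in> R) \<mu> \<mu>')"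
proof -
  have "dist_ref (region_reach K E) (region_reach K' E') R \<mu> \<mu>' \<longleftrightarrow>
      rel_pmf (\<lambda>s s'. (s, s') \<in> R) \<mu> \<mu>'" if "\<mu> \<in> \<zeta>" "\<mu>' \<in> \<zeta>'" for \<mu> \<mu>'
    using region_reach_set_pmf[OF assms(1,2) that(1)] region_reach_set_pmf[OF assms(3,4) that(2)]
      dist_ref_imp_rel_pmf rel_pmf_imp_dist_ref by metis
  then show ?thesis
    by (auto simp: constraint_ref_def)
qed

lemma edge_le_ceil_of:
  assumes "edge E l g a \<phi> \<noteq> Bot" "(x, r, c) \<in> set g"
  shows "enat c \<le> ceil_of E x"
  unfolding ceil_of_def using assms by (intro Sup_upper) blast

text \<open>\<open>delayed K A \<theta>0 \<theta>\<close> records that \<open>\<theta>\<close>, seen on the clocks \<open>A\<close>, is a time successor of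
  \<open>\<theta>0\<close>. One pair of valuations is enough as witness, since all valuations of \<open>\<theta>0\<close> are
  region equivalent.\<close>

definition delayed :: "('a \<Rightarrow> enat) \<Rightarrow> 'a set \<Rightarrow> 'a region \<Rightarrow> 'a region \<Rightarrow> bool" where
  "delayed K A \<theta>0 \<theta> \<longleftrightarrow> \<theta>0 \<subseteq> valuations A \<and> (\<forall>u\<in>\<theta>0. \<forall>v\<in>\<theta>0. region_equiv K A u v) \<and>
     (\<exists>u\<in>\<theta>0. \<exists>d\<ge>0. \<exists>v\<in>\<theta>. restrict v A = elapse A u d)"

text \<open>One valuation \<open>w\<close> of \<open>\<theta>''\<close>, reached from the witness
  \<open>v\<close>, fixes \<open>\<theta>1\<close> as the region of its projection.
  \<open>region_equiv_coarsen\<close> sends the rest of \<open>\<theta>''\<close> there, and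
  \<open>region_equiv_elapse\<close> does so for delays from the rest of \<open>\<theta>0\<close>.
  The last two conclusions restore the invariant after an action inside or outside
  \<open>A\<close>.\<close>

lemma delayed_step:
  assumes del: "delayed K A \<theta>0 \<theta>" and \<theta>'': "\<theta>'' \<in> regions K' A'" and succ: "time_succ A' \<theta> \<theta>''"
    and fin: "finite A" and sub: "A \<subseteq> A'" and le: "\<And>x. x \<in> A \<Longrightarrow> K x \<le> K' x"
  obtains \<theta>1 where "\<theta>1 \<in> regions K A" "time_succ A \<theta>0 \<theta>1"
    "\<And>v. v \<in> \<theta>'' \<Longrightarrow> restrict v A \<in> \<theta>1"
    "\<And>u v. u \<in> \<theta>1 \<Longrightarrow> v \<in> \<theta>1 \<Longrightarrow> region_equiv K A u v"
    "\<theta>'' \<noteq> {}"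
    "\<And>a. a \<in> A \<Longrightarrow> delayed K A (region_reset a \<theta>1) (region_reset a \<theta>'')"
    "\<And>a. a \<notin> A \<Longrightarrow> delayed K A \<theta>0 (region_reset a \<theta>'')"
proof -
  obtain u d v where u: "u \<in> \<theta>0" and d: "0 \<le> d" and v: "v \<in> \<theta>" and eq: "restrict v A = elapse A u d"
    using del by (auto simp: delayed_def)
  have val0: "\<theta>0 \<subseteq> valuations A" and equiv0: "\<And>v w. v \<in> \<theta>0 \<Longrightarrow> w \<in> \<theta>0 \<Longrightarrow> region_equiv K A v w"
    using del by (auto simp: delayed_def)
  obtain d2 where d2: "0 \<le> d2" and w: "elapse A' v d2 \<in> \<theta>''"
    using succ v by (auto simp: time_succ_def)
  define w where "w = elapse A' v d2"
  define \<theta>1 where "\<theta>1 = region_of K A (restrict w A)"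
  \<comment> \<open>The delay accumulated so far and the new one form a single delay from
    \<open>u\<close>.\<close>
  have eqw: "restrict w A = elapse A u (d + d2)"
  proof (rule ext)
    fix x show "restrict w A x = elapse A u (d + d2) x"
      using sub fun_cong[OF eq, of x] by (auto simp: w_def elapse_def)
  qed
  obtain w0 where "\<theta>'' = region_of K' A' w0"
    using \<theta>'' by (auto simp: regions_def)
  then have val'': "\<theta>'' \<subseteq> valuations A'" and
    equiv'': "\<And>v w. v \<in> \<theta>'' \<Longrightarrow> w \<in> \<theta>'' \<Longrightarrow> region_equiv K' A' v w"
    by (auto simp: region_of_def intro: region_of_equiv)
  have w'': "w \<in> \<theta>''"
    using w by (simp add: w_def)
  have wval: "restrict w A \<in> valuations A"
    using w'' val'' sub by (blast intro: valuations_restrict)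
  have in1: "restrict v A \<in> \<theta>1" if "v \<in> \<theta>''" for v
    using that w'' val'' sub region_equiv_coarsen[OF equiv'' sub le]
    by (auto simp: \<theta>1_def region_of_def intro: valuations_restrict)
  have equiv1: "region_equiv K A u v" if "u \<in> \<theta>1" "v \<in> \<theta>1" for u v
    using that region_of_equiv by (auto simp: \<theta>1_def)
  show thesis
  proof (rule that[of \<theta>1])
    show "\<theta>1 \<in> regions K A"
      using wval by (auto simp: regions_def \<theta>1_def)
    show "time_succ A \<theta>0 \<theta>1"
      unfolding time_succ_def
    proof
      fix u' assume u': "u' \<in> \<theta>0"
      obtain e where e: "0 \<le> e" "region_equiv K A (elapse A u (d + d2)) (elapse A u' e)"
        using region_equiv_elapse[OF fin equiv0[OF u u'], of "d + d2"] d d2 by auto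
      then have "elapse A u' e \<in> \<theta>1"
        using u' val0 by (auto simp: \<theta>1_def region_of_def eqw intro: valuations_elapse)
      then show "\<exists>d\<ge>0. elapse A u' d \<in> \<theta>1"
        using e(1) by blast
    qed
    show "\<theta>'' \<noteq> {}"
      using w'' by blast
    show "delayed K A (region_reset a \<theta>1) (region_reset a \<theta>'')" if a: "a \<in> A" for a
      unfolding delayed_def
    proof (intro conjI)
      show "region_reset a \<theta>1 \<subseteq> valuations A"
        using a by (auto simp: region_reset_def \<theta>1_def region_of_def intro: valuations_reset)
      show "\<forall>u\<in>region_reset a \<theta>1. \<forall>v\<in>region_reset a \<theta>1. region_equiv K A u v"
        using equiv1 by (auto simp: region_reset_def intro: region_equiv_reset)
      \<comment> \<open>Reset commutes with projection, so after an action of the component the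
        delay restarts at 0.\<close>
      have "restrict (w(a := 0)) A = elapse A ((restrict w A)(a := 0)) 0"
        by (auto simp: elapse_def fun_eq_iff)
      moreover have "(restrict w A)(a := 0) \<in> region_reset a \<theta>1" "w(a := 0) \<in> region_reset a \<theta>''"
        using in1 w'' by (auto simp: region_reset_def)
      ultimately
      show "\<exists>u\<in>region_reset a \<theta>1. \<exists>d\<ge>0. \<exists>v\<in>region_reset a \<theta>''. restrict v A = elapse A u d"
        by (metis order_refl)
    qed
    show "delayed K A \<theta>0 (region_reset a \<theta>'')" if a: "a \<notin> A" for a
    proof -
      \<comment> \<open>The projection does not see clock \<open>a\<close>, so
        \<open>\<theta>0\<close> remains the origin and the delay accumulates.\<close>
      have "restrict (w(a := 0)) A = elapse A u (d + d2)"
        unfolding eqw[symmetric] using a by (auto simp: fun_eq_iff restrict_def)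
      moreover have "w(a := 0) \<in> region_reset a \<theta>''"
        using w'' by (auto simp: region_reset_def)
      ultimately show ?thesis
        using val0 equiv0 u d d2 unfolding delayed_def by (metis add_nonneg_nonneg)
    qed
  qed (use in1 equiv1 in auto)
qed

section \<open>Composition, independently of the order of its factors\<close>

abbreviation prod_con :: "('l \<times> 'n \<Rightarrow> 'c) \<Rightarrow> 'l constraint \<Rightarrow> 'n constraint \<Rightarrow> 'c constraint" where
  "prod_con c \<phi> \<psi> \<equiv> (\<lambda>(\<mu>, \<nu>). map_pmf c (pair_pmf \<mu> \<nu>)) ` (\<phi> \<times> \<psi>)"

text \<open>Guards are compared as sets of atoms, and \<open>c\<close> is either the identity or the swap, so
  that both orders of composition are covered.\<close>

definition composes :: "('l \<times> 'n \<Rightarrow> 'c) \<Rightarrow> ('c, 'a, 'p) apeca \<Rightarrow> ('l, 'a, 'p) apeca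
    \<Rightarrow> ('n, 'a, 'p) apeca \<Rightarrow> bool" where
  "composes c F E1 E2 \<longleftrightarrow>
     acts F = acts E1 \<union> acts E2 \<and> start F = c (start E1, start E2) \<and>
     (\<forall>l1 l2. lab F (c (l1, l2)) = {P1 \<union> P2 | P1 P2. P1 \<in> lab E1 l1 \<and> P2 \<in> lab E2 l2}) \<and>
     (\<forall>l1 l2 t g a \<phi>. t \<noteq> Bot \<and> t \<le> edge F (c (l1, l2)) g a \<phi> \<longrightarrow>
       (\<exists>g1 g2 \<phi>1 \<phi>2. set g = set g1 \<union> set g2 \<and>
         \<phi> = prod_con c \<phi>1 \<phi>2 \<and>
         t \<le> edge (equalize (acts E2) E1) l1 g1 a \<phi>1 \<and>
         t \<le> edge (equalize (acts E1) E2) l2 g2 a \<phi>2)) \<and>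
     (\<forall>l1 l2 t a g1 g2 \<phi>1 \<phi>2. t \<noteq> Bot \<and>
         t \<le> edge (equalize (acts E2) E1) l1 g1 a \<phi>1 \<and>
         t \<le> edge (equalize (acts E1) E2) l2 g2 a \<phi>2 \<longrightarrow>
       (\<exists>g. set g = set g1 \<union> set g2 \<and>
         t \<le> edge F (c (l1, l2)) g a (prod_con c \<phi>1 \<phi>2)))"

lemma composes_edgeE:
  assumes "composes c F E1 E2" "t \<noteq> Bot" "t \<le> edge F (c (l1, l2)) g a \<phi>"
  obtains g1 g2 \<phi>1 \<phi>2 where "set g = set g1 \<union> set g2"
    "\<phi> = prod_con c \<phi>1 \<phi>2"
    "t \<le> edge (equalize (acts E2) E1) l1 g1 a \<phi>1"
    "t \<le> edge (equalize (acts E1) E2) l2 g2 a \<phi>2"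
proof -
  have "\<forall>l1 l2 t g a \<phi>. t \<noteq> Bot \<and> t \<le> edge F (c (l1, l2)) g a \<phi> \<longrightarrow>
       (\<exists>g1 g2 \<phi>1 \<phi>2. set g = set g1 \<union> set g2 \<and>
         \<phi> = prod_con c \<phi>1 \<phi>2 \<and>
         t \<le> edge (equalize (acts E2) E1) l1 g1 a \<phi>1 \<and>
         t \<le> edge (equalize (acts E1) E2) l2 g2 a \<phi>2)"
    using assms(1) unfolding composes_def by (elim conjE) assumption
  then show thesis
    using assms(2,3) that by blast
qed

lemma composes_edgeI:
  assumes "composes c F E1 E2" "t \<noteq> Bot"
    "t \<le> edge (equalize (acts E2) E1) l1 g1 a \<phi>1"
    "t \<le> edge (equalize (acts E1) E2) l2 g2 a \<phi>2"
  shows "\<exists>g. set g = set g1 \<union> set g2 \<and>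
    t \<le> edge F (c (l1, l2)) g a (prod_con c \<phi>1 \<phi>2)"
  using assms unfolding composes_def by simp

text \<open>A meet lies above \<open>t\<close> iff both factors do, and
  \<open>t \<noteq> Bot\<close> then implies the two side conditions of the definition.\<close>

lemma le_edge_par_eq_iff:
  assumes "t \<noteq> Bot"
  shows "t \<le> edge (par_eq E1 E2) (l1, l2) g a \<phi> \<longleftrightarrow>
    (\<exists>g1 g2 \<phi>1 \<phi>2. g = g1 @ g2 \<and> \<phi> = prod_constraint \<phi>1 \<phi>2 \<and>
      t \<le> edge E1 l1 g1 a \<phi>1 \<and> t \<le> edge E2 l2 g2 a \<phi>2)"
proof -
  have ne: "x \<noteq> Bot" if "t \<le> x" for x
    using that assms by auto
  have "t \<le> edge (par_eq E1 E2) (l1, l2) g a \<phi> \<longleftrightarrow>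
    (\<exists>g1 g2 \<phi>1 \<phi>2. (g = g1 @ g2 \<and> \<phi> = prod_constraint \<phi>1 \<phi>2 \<and>
      edge E1 l1 g1 a \<phi>1 \<noteq> Bot \<and> edge E2 l2 g2 a \<phi>2 \<noteq> Bot) \<and>
      t \<le> min (edge E1 l1 g1 a \<phi>1) (edge E2 l2 g2 a \<phi>2))"
    unfolding par_eq_def apeca.simps case_prod_conv le_Max_insert_Bot_iff[OF assms] by blast
  then show ?thesis
    using ne unfolding min.bounded_iff by blast
qed

lemma equalize_simps [simp]:
  "acts (equalize B E) = acts E \<union> B" "start (equalize B E) = start E" "lab (equalize B E) = lab E"
  by (simp_all add: equalize_def)

lemma par_eq_simps [simp]:
  "acts (par_eq E1 E2) = acts E1" "start (par_eq E1 E2) = (start E1, start E2)"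
  "lab (par_eq E1 E2) (l1, l2) = {P1 \<union> P2 | P1 P2. P1 \<in> lab E1 l1 \<and> P2 \<in> lab E2 l2}"
  by (simp_all add: par_eq_def)

lemma composes_par: "composes (\<lambda>p. p) (E1 \<parallel> E2) E1 E2"
  unfolding composes_def par_def
  by (auto simp: le_edge_par_eq_iff prod_constraint_eq pmf.map_ident) (metis set_append)+

text \<open>Swapping coordinates turns \<open>pair_pmf \<mu> \<nu>\<close> into
  \<open>pair_pmf \<nu> \<mu>\<close>, and atom sets forget the order of concatenated
  guards.\<close>

lemma composes_par_swap: "composes (\<lambda>(l1, l2). (l2, l1)) (E2 \<parallel> E1) E1 E2"
proof -
  have "prod_constraint \<phi>2 \<phi>1 =
      (\<lambda>(\<mu>, \<nu>). map_pmf (\<lambda>(l1, l2). (l2, l1)) (pair_pmf \<mu> \<nu>)) ` (\<phi>1 \<times> \<phi>2)"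
    for \<phi>1 :: "'a pmf set" and \<phi>2 :: "'b pmf set"
    unfolding prod_constraint_eq pair_commute_pmf[symmetric] by auto
  then show ?thesis
    unfolding composes_def par_def
    by (auto simp: le_edge_par_eq_iff) (metis set_append Un_commute)+
qed

lemma edge_equalize_old:
  "a \<in> acts E \<Longrightarrow> edge (equalize B E) l g a \<phi> = edge E l g a \<phi>"
  by (simp add: equalize_def)

lemma edge_equalize_new:
  assumes "is_apeca E" "a \<notin> acts E"
  shows "edge (equalize B E) l g a \<phi> =
    (if a \<in> B \<and> l \<in> locs E \<and> g = [] \<and> \<phi> = {return_pmf l} then Must else Bot)"
proof -
  have "edge E l g a \<phi> = Bot"
    using assms unfolding is_apeca_def by blast
  then show ?thesis
    using assms(2) by (simp add: equalize_def)
qed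

text \<open>For an own action totality is applied at the zero valuation; for an added action the
  loop serves. \<open>start E\<close> is chosen as a location known to exist.\<close>

lemma ex_edge_equalize:
  assumes E: "is_apeca E" and a: "a \<in> acts E \<union> B"
  obtains g \<phi> where "edge (equalize B E) (start E) g a \<phi> \<noteq> Bot"
proof (cases "a \<in> acts E")
  case True
  have "(\<lambda>x\<in>acts E. 0) \<in> valuations (acts E)"
    by (auto simp: valuations_def)
  then obtain g \<phi> where "edge E (start E) g a \<phi> \<noteq> Bot"
    using E True unfolding is_apeca_def by metis
  then show ?thesis
    using that edge_equalize_old[OF True] by metis
next
  case False
  then show ?thesis
    using E a that[of "[]" "{return_pmf (start E)}"]
    by (simp add: edge_equalize_new is_apeca_def)
qed

text \<open>Totality of \<open>E2\<close> is essential here: it ensures that every edge of \<open>E1\<close> survives in the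
  composition, so that composing can only refine the regions.\<close>

lemma ceil_of_le_composes:
  assumes "is_apeca E1" "is_apeca E2" "composes c F E1 E2"
  shows "ceil_of E1 x \<le> ceil_of F x"
  unfolding ceil_of_def[of E1]
proof (rule Sup_least, clarify)
  fix k l g a \<phi> r assume e: "edge E1 l g a \<phi> \<noteq> Bot" and x: "(x, r, k) \<in> set g"
  have a: "a \<in> acts E1"
    using e assms(1) by (auto simp: is_apeca_def)
  obtain g2 \<phi>2 where e2: "edge (equalize (acts E1) E2) (start E2) g2 a \<phi>2 \<noteq> Bot"
    using ex_edge_equalize[OF assms(2), of a "acts E1"] a by blast
  have "May \<le> edge (equalize (acts E2) E1) l g a \<phi>"
    "May \<le> edge (equalize (acts E1) E2) (start E2) g2 a \<phi>2"
    using e e2 a by (simp_all add: edge_equalize_old)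
  then obtain g' \<psi> where "set g' = set g \<union> set g2" "May \<le> edge F (c (l, start E2)) g' a \<psi>"
    using composes_edgeI[OF assms(3)] by blast
  then show "enat k \<le> ceil_of F x"
    using x by (intro edge_le_ceil_of[where g = g' and r = r]) auto
qed

lemma guard_sat_set_Un:
  "set g = set g1 \<union> set g2 \<Longrightarrow> guard_sat v g \<longleftrightarrow> guard_sat v g1 \<and> guard_sat v g2"
  unfolding guard_sat_def by blast

section \<open>Matching edges of one equalized component, with ceilings \<open>K\<close> below the
  composed ceilings \<open>K'\<close>\<close>

locale component_refinement =
  fixes E :: "('l, 'a, 'p) apeca" and E' :: "('m, 'a, 'p) apeca"
    and K K' :: "'a \<Rightarrow> enat" and B :: "'a set" and R
  assumes apeca: "is_apeca E" and apeca': "is_apeca E'" and acts_eq: "acts E' = acts E"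
    and ceil: "\<And>x. ceil_of E x \<le> K x" and ceil': "\<And>x. ceil_of E' x \<le> K x"
    and K_le: "\<And>x. K x \<le> K' x"
    and ref: "weak_ref_rel (region_automaton K E) (region_automaton K E') R"
begin

text \<open>An action outside \<open>acts E\<close> lets time pass without \<open>E\<close> taking part, which may lead to a
  region that is not reachable in the region automaton of \<open>E\<close>. Hence \<open>R\<close> is only required to
  hold at some region \<open>\<theta>0\<close> from which the current one is reached by a delay.\<close>

definition tracked :: "'a region \<Rightarrow> 'l \<Rightarrow> 'm \<Rightarrow> bool" where
  "tracked \<theta> l l' \<longleftrightarrow> (\<exists>\<theta>0. ((l, \<theta>0), (l', \<theta>0)) \<in> R \<and> delayed K (acts E) \<theta>0 \<theta>)"

lemma R_reach:
  assumes "(s, s') \<in> R"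
  shows "s \<in> region_reach K E" "s' \<in> region_reach K E'"
  using assms ref by (auto simp: weak_ref_rel_def region_automaton_def)

lemma R_must:
  assumes "(s, s') \<in> R" "region_trans K E' s' b \<phi>' = Must"
  shows "\<exists>\<phi>. region_trans K E s b \<phi> = Must \<and>
    constraint_ref (region_reach K E) (region_reach K E') R \<phi> \<phi>'"
  using assms ref unfolding weak_ref_rel_def region_automaton_def apa.simps by blast

lemma R_may:
  assumes "(s, s') \<in> R" "region_trans K E s b \<phi> \<noteq> Bot"
  shows "\<exists>\<phi>'. region_trans K E' s' b \<phi>' \<noteq> Bot \<and>
    constraint_ref (region_reach K E) (region_reach K E') R \<phi> \<phi>'"
  using assms ref unfolding weak_ref_rel_def region_automaton_def apa.simps by blast

lemma tracked_lab:
  assumes "tracked \<theta> l l'"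
  shows "lab E l \<subseteq> lab E' l'"
  using assms ref unfolding tracked_def weak_ref_rel_def region_automaton_def by fastforce

lemma tracked_locs:
  assumes "tracked \<theta> l l'"
  shows "l \<in> locs E" "l' \<in> locs E'"
  using assms R_reach region_reach_locs[OF apeca] region_reach_locs[OF apeca']
  unfolding tracked_def by metis+

lemma finite_acts: "finite (acts E)"
  using apeca by (simp add: is_apeca_def)

text \<open>The constants of the guard respect \<open>K\<close>, so its truth is constant on
  \<open>\<theta>1\<close>. As \<open>\<theta>''\<close> is nonempty and projects into
  \<open>\<theta>1\<close>, one valuation settles the guard on both regions.\<close>

lemma guard_transfer:
  assumes edge: "(\<exists>l \<phi>. edge E l g a \<phi> \<noteq> Bot) \<or> (\<exists>l \<phi>. edge E' l g a \<phi> \<noteq> Bot)"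
    and "\<theta>'' \<noteq> {}"
    and "\<And>v. v \<in> \<theta>'' \<Longrightarrow> restrict v (acts E) \<in> \<theta>1"
    and "\<And>u v. u \<in> \<theta>1 \<Longrightarrow> v \<in> \<theta>1 \<Longrightarrow> region_equiv K (acts E) u v"
  shows "(\<forall>v\<in>\<theta>''. guard_sat v g) \<longleftrightarrow> (\<forall>v\<in>\<theta>1. guard_sat v g)"
proof -
  have g: "g \<in> guards (acts E)"
    using edge apeca apeca' acts_eq unfolding is_apeca_def by metis
  have le: "enat c \<le> K x" if "(x, r, c) \<in> set g" for x r c
    using edge edge_le_ceil_of[OF _ that] ceil[of x] ceil'[of x] order_trans by metis
  obtain w where w: "w \<in> \<theta>''"
    using assms(2) by blast
  have "guard_sat v g" if "u \<in> \<theta>1" "v \<in> \<theta>1" "guard_sat u g" for u v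
    by (rule region_equiv_guard_sat[OF assms(4)[OF that(1,2)] g le that(3)])
  then show ?thesis
    using w assms(3) guard_sat_restrict[OF g] by blast
qed

text \<open>All targets carry the same region \<open>\<rho>\<close>, so a coupling of states is a
  coupling of locations; the delay then moves the relation from \<open>\<rho>\<close> to
  \<open>\<theta>\<close>.\<close>

lemma constraint_ref_tracked:
  assumes "(s, s') \<in> R"
    and "region_trans K E s b (map_pmf (\<lambda>k. (k, \<rho>)) ` \<phi>) \<noteq> Bot"
    and "region_trans K E' s' b (map_pmf (\<lambda>k. (k, \<rho>)) ` \<phi>') \<noteq> Bot"
    and "constraint_ref (region_reach K E) (region_reach K E') R
      (map_pmf (\<lambda>k. (k, \<rho>)) ` \<phi>) (map_pmf (\<lambda>k. (k, \<rho>)) ` \<phi>')"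
    and "delayed K (acts E) \<rho> \<theta>"
  shows "\<forall>\<mu>\<in>\<phi>. \<exists>\<mu>'\<in>\<phi>'. rel_pmf (tracked \<theta>) \<mu> \<mu>'"
proof -
  have "\<forall>\<mu>\<in>\<phi>. \<exists>\<mu>'\<in>\<phi>'. rel_pmf (\<lambda>k k'. ((k, \<rho>), (k', \<rho>)) \<in> R) \<mu> \<mu>'"
    using assms(4) R_reach[OF assms(1)] constraint_ref_region_iff[OF _ assms(2) _ assms(3)]
    by (simp add: pmf.rel_map)
  moreover have "rel_pmf (tracked \<theta>) \<mu> \<mu>'" if "rel_pmf (\<lambda>k k'. ((k, \<rho>), (k', \<rho>)) \<in> R) \<mu> \<mu>'" for \<mu> \<mu>'
    by (rule pmf.rel_mono_strong[OF that]) (use assms(5) in \<open>auto simp: tracked_def\<close>)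
  ultimately show ?thesis
    by blast
qed

text \<open>An action of the component is carried down from \<open>\<theta>''\<close> to
  \<open>\<theta>1\<close>, answered there through \<open>R\<close>, and the guard of the answer is
  carried back up. For a foreign action neither side moves.\<close>

lemma match_must:
  assumes tr: "tracked \<theta> l l'" and \<theta>'': "\<theta>'' \<in> regions K' (acts E \<union> B)"
    and succ: "time_succ (acts E \<union> B) \<theta> \<theta>''"
    and e': "edge (equalize B E') l' g' a \<phi>' = Must" and g': "\<forall>v\<in>\<theta>''. guard_sat v g'"
  shows "\<exists>g \<phi>. edge (equalize B E) l g a \<phi> = Must \<and> (\<forall>v\<in>\<theta>''. guard_sat v g) \<and>
    (\<forall>\<mu>\<in>\<phi>. \<exists>\<mu>'\<in>\<phi>'. rel_pmf (tracked (region_reset a \<theta>'')) \<mu> \<mu>')"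
proof -
  obtain \<theta>0 where R: "((l, \<theta>0), (l', \<theta>0)) \<in> R" and del: "delayed K (acts E) \<theta>0 \<theta>"
    using tr by (auto simp: tracked_def)
  obtain \<theta>1 where \<theta>1: "\<theta>1 \<in> regions K (acts E)" "time_succ (acts E) \<theta>0 \<theta>1"
    and sub: "\<And>v. v \<in> \<theta>'' \<Longrightarrow> restrict v (acts E) \<in> \<theta>1"
    and equiv: "\<And>u v. u \<in> \<theta>1 \<Longrightarrow> v \<in> \<theta>1 \<Longrightarrow> region_equiv K (acts E) u v"
    and ne: "\<theta>'' \<noteq> {}"
    and del_in: "a \<in> acts E \<Longrightarrow> delayed K (acts E) (region_reset a \<theta>1) (region_reset a \<theta>'')"
    and del_out: "a \<notin> acts E \<Longrightarrow> delayed K (acts E) \<theta>0 (region_reset a \<theta>'')"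
    by (rule delayed_step[OF del \<theta>'' succ finite_acts Un_upper1 K_le]) blast
  note transfer = guard_transfer[OF _ ne sub equiv]
  show ?thesis
  proof (cases "a \<in> acts E")
    case True
    let ?f = "map_pmf (\<lambda>k. (k, region_reset a \<theta>1))"
    have e'': "edge E' l' g' a \<phi>' = Must"
      using e' True acts_eq by (simp add: edge_equalize_old)
    then have "\<forall>v\<in>\<theta>1. guard_sat v g'"
      using transfer[of g' a] g' by fastforce
    \<comment> \<open>\<open>R\<close> is known to hold at \<open>\<theta>0\<close>, so the edge is
      replayed from \<open>\<theta>0\<close> and not from the projection of
      \<open>\<theta>\<close>.\<close>
    then have "Must \<le> region_trans K E' (l', \<theta>0) (\<theta>1, a) (?f ` \<phi>')"
      using \<theta>1 e'' acts_eq by (subst le_region_trans_iff) auto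
    then have tr': "region_trans K E' (l', \<theta>0) (\<theta>1, a) (?f ` \<phi>') = Must"
      by simp
    obtain \<zeta> where \<zeta>: "region_trans K E (l, \<theta>0) (\<theta>1, a) \<zeta> = Must"
        and cref: "constraint_ref (region_reach K E) (region_reach K E') R \<zeta> (?f ` \<phi>')"
      using R_must[OF R tr'] by blast
    from \<zeta> have "Must \<le> region_trans K E (l, \<theta>0) (\<theta>1, a) \<zeta>"
      by simp
    then obtain g \<phi> where e: "edge E l g a \<phi> = Must" and g: "\<forall>v\<in>\<theta>1. guard_sat v g"
        and \<zeta>_eq: "\<zeta> = ?f ` \<phi>"
      by (subst (asm) le_region_trans_iff) auto
    have "\<forall>\<mu>\<in>\<phi>. \<exists>\<mu>'\<in>\<phi>'. rel_pmf (tracked (region_reset a \<theta>'')) \<mu> \<mu>'"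
      using \<zeta> tr' cref \<zeta>_eq del_in[OF True]
      by (intro constraint_ref_tracked[OF R, where b = "(\<theta>1, a)"]) auto
    moreover have "\<forall>v\<in>\<theta>''. guard_sat v g"
      using transfer[of g a] e g by fastforce
    ultimately show ?thesis
      using e True by (auto simp: edge_equalize_old)
  next
    case False
    \<comment> \<open>The only possible edge is the loop added by \<open>equalize\<close>.
      \<open>E\<close> answers with its own loop, and the delay absorbs the elapsed time.\<close>
    then have "a \<in> B" "\<phi>' = {return_pmf l'}"
      using e' apeca' acts_eq by (auto simp: edge_equalize_new split: if_splits)
    moreover have "tracked (region_reset a \<theta>'') l l'"
      using R del_out[OF False] by (auto simp: tracked_def)
    ultimately show ?thesis
      using False apeca tracked_locs[OF tr]
      by (intro exI[of _ "[]"] exI[of _ "{return_pmf l}"])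
        (simp add: edge_equalize_new guard_sat_def)
  qed
qed

text \<open>The same round trip in the opposite direction, from an edge of \<open>E\<close> through
  the clause of refinement for arbitrary edges.\<close>

lemma match_may:
  assumes tr: "tracked \<theta> l l'" and \<theta>'': "\<theta>'' \<in> regions K' (acts E \<union> B)"
    and succ: "time_succ (acts E \<union> B) \<theta> \<theta>''"
    and e: "edge (equalize B E) l g a \<phi> \<noteq> Bot" and g: "\<forall>v\<in>\<theta>''. guard_sat v g"
  shows "\<exists>g' \<phi>'. edge (equalize B E') l' g' a \<phi>' \<noteq> Bot \<and> (\<forall>v\<in>\<theta>''. guard_sat v g') \<and>
    (\<forall>\<mu>\<in>\<phi>. \<exists>\<mu>'\<in>\<phi>'. rel_pmf (tracked (region_reset a \<theta>'')) \<mu> \<mu>')"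
proof -
  obtain \<theta>0 where R: "((l, \<theta>0), (l', \<theta>0)) \<in> R" and del: "delayed K (acts E) \<theta>0 \<theta>"
    using tr by (auto simp: tracked_def)
  obtain \<theta>1 where \<theta>1: "\<theta>1 \<in> regions K (acts E)" "time_succ (acts E) \<theta>0 \<theta>1"
    and sub: "\<And>v. v \<in> \<theta>'' \<Longrightarrow> restrict v (acts E) \<in> \<theta>1"
    and equiv: "\<And>u v. u \<in> \<theta>1 \<Longrightarrow> v \<in> \<theta>1 \<Longrightarrow> region_equiv K (acts E) u v"
    and ne: "\<theta>'' \<noteq> {}"
    and del_in: "a \<in> acts E \<Longrightarrow> delayed K (acts E) (region_reset a \<theta>1) (region_reset a \<theta>'')"
    and del_out: "a \<notin> acts E \<Longrightarrow> delayed K (acts E) \<theta>0 (region_reset a \<theta>'')"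
    by (rule delayed_step[OF del \<theta>'' succ finite_acts Un_upper1 K_le]) blast
  note transfer = guard_transfer[OF _ ne sub equiv]
  show ?thesis
  proof (cases "a \<in> acts E")
    case True
    let ?f = "map_pmf (\<lambda>k. (k, region_reset a \<theta>1))"
    have e1: "edge E l g a \<phi> \<noteq> Bot"
      using e True by (simp add: edge_equalize_old)
    then have "\<forall>v\<in>\<theta>1. guard_sat v g"
      using transfer[of g a] g by blast
    then have "May \<le> region_trans K E (l, \<theta>0) (\<theta>1, a) (?f ` \<phi>)"
      using \<theta>1 e1 by (subst le_region_trans_iff) auto
    then have tr1: "region_trans K E (l, \<theta>0) (\<theta>1, a) (?f ` \<phi>) \<noteq> Bot"
      by simp
    obtain \<zeta>' where \<zeta>': "region_trans K E' (l', \<theta>0) (\<theta>1, a) \<zeta>' \<noteq> Bot"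
        and cref: "constraint_ref (region_reach K E) (region_reach K E') R (?f ` \<phi>) \<zeta>'"
      using R_may[OF R tr1] by blast
    from \<zeta>' have "May \<le> region_trans K E' (l', \<theta>0) (\<theta>1, a) \<zeta>'"
      by simp
    then obtain g' \<phi>' where e': "edge E' l' g' a \<phi>' \<noteq> Bot" and g': "\<forall>v\<in>\<theta>1. guard_sat v g'"
        and \<zeta>_eq: "\<zeta>' = ?f ` \<phi>'"
      by (subst (asm) le_region_trans_iff) auto
    have "\<forall>\<mu>\<in>\<phi>. \<exists>\<mu>'\<in>\<phi>'. rel_pmf (tracked (region_reset a \<theta>'')) \<mu> \<mu>'"
      using \<zeta>' tr1 cref \<zeta>_eq del_in[OF True]
      by (intro constraint_ref_tracked[OF R, where b = "(\<theta>1, a)"]) auto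
    moreover have "\<forall>v\<in>\<theta>''. guard_sat v g'"
      using transfer[of g' a] e' g' by blast
    ultimately show ?thesis
      using e' True acts_eq by (auto simp: edge_equalize_old)
  next
    case False
    then have "a \<in> B" "\<phi> = {return_pmf l}"
      using e apeca by (auto simp: edge_equalize_new split: if_splits)
    moreover have "tracked (region_reset a \<theta>'') l l'"
      using R del_out[OF False] by (auto simp: tracked_def)
    ultimately show ?thesis
      using False apeca' acts_eq tracked_locs[OF tr]
      by (intro exI[of _ "[]"] exI[of _ "{return_pmf l'}"])
        (simp add: edge_equalize_new guard_sat_def)
  qed
qed

end

section \<open>Lifting the match to compositions with the common factor \<open>E2\<close>\<close>

locale composed_refinement = component_refinement E E' K K' "acts E2" R
  for E :: "('l, 'a, 'p) apeca" and E' :: "('m, 'a, 'p) apeca" and K K' R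
    and E2 :: "('n, 'a, 'p) apeca" +
  fixes c :: "'l \<times> 'n \<Rightarrow> 'c" and F :: "('c, 'a, 'p) apeca"
    and c' :: "'m \<times> 'n \<Rightarrow> 'd" and F' :: "('d, 'a, 'p) apeca"
  assumes comp: "composes c F E E2" and comp': "composes c' F' E' E2"
    and init: "(region_init K E, region_init K E') \<in> R"
begin

text \<open>Reachability is imposed explicitly: \<open>tracked\<close> concerns only the component
  automata, whereas a refinement relation must lie within the composed state spaces.\<close>

definition R_comp :: "(('c \<times> 'a region) \<times> ('d \<times> 'a region)) set" where
  "R_comp = {((c (l, m), \<theta>), (c' (l', m), \<theta>)) | l l' m \<theta>. tracked \<theta> l l' \<and>
     (c (l, m), \<theta>) \<in> region_reach K' F \<and> (c' (l', m), \<theta>) \<in> region_reach K' F'}"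

lemma comp_acts: "acts F = acts E \<union> acts E2" "acts F' = acts E \<union> acts E2"
  using comp comp' acts_eq by (simp_all add: composes_def)

lemma constraint_ref_prod:
  assumes s: "s \<in> region_reach K' F"
      "region_trans K' F s b (map_pmf (\<lambda>k. (k, \<rho>)) ` prod_con c \<phi> \<psi>) \<noteq> Bot"
    and s': "s' \<in> region_reach K' F'"
      "region_trans K' F' s' b (map_pmf (\<lambda>k. (k, \<rho>)) ` prod_con c' \<phi>' \<psi>) \<noteq> Bot"
    and rel: "\<forall>\<mu>\<in>\<phi>. \<exists>\<mu>'\<in>\<phi>'. rel_pmf (tracked \<rho>) \<mu> \<mu>'"
  shows "constraint_ref (region_reach K' F) (region_reach K' F') R_comp
    (map_pmf (\<lambda>k. (k, \<rho>)) ` prod_con c \<phi> \<psi>) (map_pmf (\<lambda>k. (k, \<rho>)) ` prod_con c' \<phi>' \<psi>)"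
proof -
  let ?h = "\<lambda>f \<mu> \<nu>. map_pmf (\<lambda>k. (k, \<rho>)) (map_pmf f (pair_pmf \<mu> \<nu>))"
  have "rel_pmf (\<lambda>s s'. (s, s') \<in> R_comp) (?h c \<mu> \<nu>) (?h c' \<mu>' \<nu>)"
    if mem: "\<mu> \<in> \<phi>" "\<mu>' \<in> \<phi>'" "\<nu> \<in> \<psi>" and r: "rel_pmf (tracked \<rho>) \<mu> \<mu>'" for \<mu> \<mu>' \<nu>
  proof -
    \<comment> \<open>\<open>R_comp\<close> asks for reachability. The given edges guarantee it on
      the supports, which is all that \<open>pmf.rel_mono_strong\<close> requires.\<close>
    have reach: "set_pmf (?h c \<mu> \<nu>) \<subseteq> region_reach K' F" "set_pmf (?h c' \<mu>' \<nu>) \<subseteq> region_reach K' F'"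
      by (intro region_reach_set_pmf[OF s] region_reach_set_pmf[OF s'] imageI, use mem in force)+
    \<comment> \<open>Coupling \<open>\<nu>\<close> with itself by equality keeps both sides in the
      same location of \<open>E2\<close>.\<close>
    have "rel_pmf (rel_prod (tracked \<rho>) (=)) (pair_pmf \<mu> \<nu>) (pair_pmf \<mu>' \<nu>)"
      using r by (simp add: rel_pmf_rel_prod pmf.rel_eq)
    then have "rel_pmf (\<lambda>x y. ((c x, \<rho>), (c' y, \<rho>)) \<in> R_comp) (pair_pmf \<mu> \<nu>) (pair_pmf \<mu>' \<nu>)"
    proof (rule pmf.rel_mono_strong)
      fix x y
      assume "x \<in> set_pmf (pair_pmf \<mu> \<nu>)" "y \<in> set_pmf (pair_pmf \<mu>' \<nu>)"
        "rel_prod (tracked \<rho>) (=) x y"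
      moreover have "(c x, \<rho>) \<in> region_reach K' F" if "x \<in> set_pmf (pair_pmf \<mu> \<nu>)"
        using reach(1) that by (auto simp: image_image)
      moreover have "(c' y, \<rho>) \<in> region_reach K' F'" if "y \<in> set_pmf (pair_pmf \<mu>' \<nu>)"
        using reach(2) that by (auto simp: image_image)
      ultimately show "((c x, \<rho>), (c' y, \<rho>)) \<in> R_comp"
        by (cases x; cases y) (auto simp: R_comp_def)
    qed
    then show ?thesis
      by (simp add: pmf.rel_map)
  qed
  then have "\<forall>\<mu>\<in>map_pmf (\<lambda>k. (k, \<rho>)) ` prod_con c \<phi> \<psi>.
      \<exists>\<mu>'\<in>map_pmf (\<lambda>k. (k, \<rho>)) ` prod_con c' \<phi>' \<psi>. rel_pmf (\<lambda>s s'. (s, s') \<in> R_comp) \<mu> \<mu>'"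
    using rel by (auto simp: Bex_def image_iff) blast
  then show ?thesis
    using constraint_ref_region_iff[OF s s'] by blast
qed

text \<open>A composed must-edge splits into must-edges of both factors. The one of
  \<open>E2\<close> is reused with its guard, which already holds on \<open>\<theta>''\<close>; only
  the one of \<open>E'\<close> is replaced by its match.\<close>

lemma R_comp_must:
  assumes tr: "tracked \<theta> l l'"
    and reach: "(c (l, m), \<theta>) \<in> region_reach K' F" "(c' (l', m), \<theta>) \<in> region_reach K' F'"
    and must: "region_trans K' F' (c' (l', m), \<theta>) (\<theta>'', a) \<zeta>' = Must"
  shows "\<exists>\<zeta>. region_trans K' F (c (l, m), \<theta>) (\<theta>'', a) \<zeta> = Must \<and>
    constraint_ref (region_reach K' F) (region_reach K' F') R_comp \<zeta> \<zeta>'"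
proof -
  let ?f = "map_pmf (\<lambda>k. (k, region_reset a \<theta>''))"
  have "Must \<le> region_trans K' F' (c' (l', m), \<theta>) (\<theta>'', a) \<zeta>'"
    using must by simp
  then obtain g' \<phi>' where \<theta>'': "\<theta>'' \<in> regions K' (acts E \<union> acts E2)"
      "time_succ (acts E \<union> acts E2) \<theta> \<theta>''"
    and e': "Must \<le> edge F' (c' (l', m)) g' a \<phi>'" and g': "\<forall>v\<in>\<theta>''. guard_sat v g'"
    and \<zeta>': "\<zeta>' = ?f ` \<phi>'"
    by (subst (asm) le_region_trans_iff) (auto simp: comp_acts)
  obtain g1' g2 \<phi>1' \<phi>2 where dec: "set g' = set g1' \<union> set g2" "\<phi>' = prod_con c' \<phi>1' \<phi>2"
    "Must \<le> edge (equalize (acts E2) E') l' g1' a \<phi>1'"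
    "Must \<le> edge (equalize (acts E) E2) m g2 a \<phi>2"
    by (rule composes_edgeE[OF comp' b3.distinct(4) e', unfolded acts_eq]) blast
  have gs: "\<forall>v\<in>\<theta>''. guard_sat v g1'" "\<forall>v\<in>\<theta>''. guard_sat v g2"
    using g' by (auto simp: guard_sat_set_Un[OF dec(1)])
  obtain g1 \<phi>1 where e1: "edge (equalize (acts E2) E) l g1 a \<phi>1 = Must" "\<forall>v\<in>\<theta>''. guard_sat v g1"
    and rel: "\<forall>\<mu>\<in>\<phi>1. \<exists>\<mu>'\<in>\<phi>1'. rel_pmf (tracked (region_reset a \<theta>'')) \<mu> \<mu>'"
    using match_must[OF tr \<theta>'' dec(3)[unfolded b3_Must_le_iff] gs(1)] by blast
  obtain g where g: "set g = set g1 \<union> set g2" "Must \<le> edge F (c (l, m)) g a (prod_con c \<phi>1 \<phi>2)"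
    using composes_edgeI[OF comp _ _ dec(4), of l g1 \<phi>1] e1(1) by auto
  have "Must \<le> region_trans K' F (c (l, m), \<theta>) (\<theta>'', a) (?f ` prod_con c \<phi>1 \<phi>2)"
    using \<theta>'' e1(2) gs(2)
    by (intro le_region_transI[OF _ _ _ g(2)]) (auto simp: comp_acts guard_sat_set_Un[OF g(1)])
  then have must1: "region_trans K' F (c (l, m), \<theta>) (\<theta>'', a) (?f ` prod_con c \<phi>1 \<phi>2) = Must"
    by simp
  have "constraint_ref (region_reach K' F) (region_reach K' F') R_comp
      (?f ` prod_con c \<phi>1 \<phi>2) (?f ` prod_con c' \<phi>1' \<phi>2)"
    using must must1 \<zeta>' dec(2)
    by (intro constraint_ref_prod[OF reach(1) _ reach(2) _ rel, where b = "(\<theta>'', a)"]) simp_all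
  then show ?thesis
    using must1 \<zeta>' dec(2) by blast
qed

text \<open>With threshold \<open>May\<close> the same splitting applies to edges of any kind, and
  the factor of \<open>E\<close> is replaced by an edge of \<open>E'\<close>.\<close>

lemma R_comp_may:
  assumes tr: "tracked \<theta> l l'"
    and reach: "(c (l, m), \<theta>) \<in> region_reach K' F" "(c' (l', m), \<theta>) \<in> region_reach K' F'"
    and may: "region_trans K' F (c (l, m), \<theta>) (\<theta>'', a) \<zeta> \<noteq> Bot"
  shows "\<exists>\<zeta>'. region_trans K' F' (c' (l', m), \<theta>) (\<theta>'', a) \<zeta>' \<noteq> Bot \<and>
    constraint_ref (region_reach K' F) (region_reach K' F') R_comp \<zeta> \<zeta>'"
proof -
  let ?f = "map_pmf (\<lambda>k. (k, region_reset a \<theta>''))"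
  have "May \<le> region_trans K' F (c (l, m), \<theta>) (\<theta>'', a) \<zeta>"
    using may by simp
  then obtain g \<phi> where \<theta>'': "\<theta>'' \<in> regions K' (acts E \<union> acts E2)"
      "time_succ (acts E \<union> acts E2) \<theta> \<theta>''"
    and e: "May \<le> edge F (c (l, m)) g a \<phi>" and g: "\<forall>v\<in>\<theta>''. guard_sat v g" and \<zeta>: "\<zeta> = ?f ` \<phi>"
    by (subst (asm) le_region_trans_iff) (auto simp: comp_acts)
  obtain g1 g2 \<phi>1 \<phi>2 where dec: "set g = set g1 \<union> set g2" "\<phi> = prod_con c \<phi>1 \<phi>2"
    "May \<le> edge (equalize (acts E2) E) l g1 a \<phi>1" "May \<le> edge (equalize (acts E) E2) m g2 a \<phi>2"
    by (rule composes_edgeE[OF comp b3.distinct(2) e]) blast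
  have gs: "\<forall>v\<in>\<theta>''. guard_sat v g1" "\<forall>v\<in>\<theta>''. guard_sat v g2"
    using g by (auto simp: guard_sat_set_Un[OF dec(1)])
  obtain g1' \<phi>1' where e1: "edge (equalize (acts E2) E') l' g1' a \<phi>1' \<noteq> Bot"
      "\<forall>v\<in>\<theta>''. guard_sat v g1'"
    and rel: "\<forall>\<mu>\<in>\<phi>1. \<exists>\<mu>'\<in>\<phi>1'. rel_pmf (tracked (region_reset a \<theta>'')) \<mu> \<mu>'"
    using match_may[OF tr \<theta>'' dec(3)[unfolded b3_May_le_iff] gs(1)] by blast
  obtain g' where g': "set g' = set g1' \<union> set g2"
      "May \<le> edge F' (c' (l', m)) g' a (prod_con c' \<phi>1' \<phi>2)"
    using composes_edgeI[OF comp', of May l' g1' a \<phi>1' m g2 \<phi>2] e1(1) dec(4) acts_eq by auto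
  have "May \<le> region_trans K' F' (c' (l', m), \<theta>) (\<theta>'', a) (?f ` prod_con c' \<phi>1' \<phi>2)"
    using \<theta>'' e1(2) gs(2)
    by (intro le_region_transI[OF _ _ _ g'(2)]) (auto simp: comp_acts guard_sat_set_Un[OF g'(1)])
  then have may': "region_trans K' F' (c' (l', m), \<theta>) (\<theta>'', a) (?f ` prod_con c' \<phi>1' \<phi>2) \<noteq> Bot"
    by simp
  have "constraint_ref (region_reach K' F) (region_reach K' F') R_comp
      (?f ` prod_con c \<phi>1 \<phi>2) (?f ` prod_con c' \<phi>1' \<phi>2)"
    using may may' \<zeta> dec(2)
    by (intro constraint_ref_prod[OF reach(1) _ reach(2) _ rel, where b = "(\<theta>'', a)"]) simp_all
  then show ?thesis
    using may' \<zeta> dec(2) by blast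
qed

lemma weak_ref_rel_R_comp:
  "weak_ref_rel (region_automaton K' F) (region_automaton K' F') R_comp"
proof -
  have lab: "lab F (c (l, m)) \<subseteq> lab F' (c' (l', m))" if "tracked \<theta> l l'" for l l' m \<theta>
    using comp comp' tracked_lab[OF that] by (auto simp: composes_def)
  show ?thesis
    unfolding weak_ref_rel_def region_automaton_def apa.simps
  proof (intro conjI ballI)
    show "R_comp \<subseteq> region_reach K' F \<times> region_reach K' F'"
      by (auto simp: R_comp_def)
    fix p assume "p \<in> R_comp"
    then obtain l l' m \<theta> where p: "p = ((c (l, m), \<theta>), (c' (l', m), \<theta>))" and tr: "tracked \<theta> l l'"
      and reach: "(c (l, m), \<theta>) \<in> region_reach K' F" "(c' (l', m), \<theta>) \<in> region_reach K' F'"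
      unfolding R_comp_def by blast
    show "case p of (s1, s2) \<Rightarrow>
        (\<forall>b \<phi>2. region_trans K' F' s2 b \<phi>2 = Must \<longrightarrow>
           (\<exists>\<phi>1. region_trans K' F s1 b \<phi>1 = Must \<and>
              constraint_ref (region_reach K' F) (region_reach K' F') R_comp \<phi>1 \<phi>2)) \<and>
        (\<forall>b \<phi>1. region_trans K' F s1 b \<phi>1 \<noteq> Bot \<longrightarrow>
           (\<exists>\<phi>2. region_trans K' F' s2 b \<phi>2 \<noteq> Bot \<and>
              constraint_ref (region_reach K' F) (region_reach K' F') R_comp \<phi>1 \<phi>2)) \<and>
        (case s1 of (l, \<theta>) \<Rightarrow> lab F l) \<subseteq> (case s2 of (l, \<theta>) \<Rightarrow> lab F' l)"
      unfolding p case_prod_conv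
      using R_comp_must[OF tr reach] R_comp_may[OF tr reach] lab[OF tr] by auto
  qed
qed

text \<open>The zero valuation on all clocks restricts to the zero valuation of the component, so
  the delay 0 is a witness.\<close>

lemma init_R_comp: "(region_init K' F, region_init K' F') \<in> R_comp"
proof -
  let ?A = "acts E" and ?z = "\<lambda>A. \<lambda>x\<in>A. 0 :: real"
  have val: "?z A \<in> valuations A" for A :: "'a set"
    by (auto simp: valuations_def)
  have "restrict (?z (?A \<union> acts E2)) ?A = elapse ?A (?z ?A) 0"
    by (auto simp: elapse_def fun_eq_iff)
  then have "\<exists>u\<in>region_of K ?A (?z ?A). \<exists>d\<ge>0. \<exists>v\<in>region_of K' (?A \<union> acts E2) (?z (?A \<union> acts E2)).
      restrict v ?A = elapse ?A u d"
    using region_of_self[OF val] by (metis order_refl)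
  then have "delayed K ?A (region_of K ?A (?z ?A))
      (region_of K' (?A \<union> acts E2) (?z (?A \<union> acts E2)))"
    unfolding delayed_def by (intro conjI ballI region_of_equiv) (auto simp: region_of_def)
  then have "tracked (region_of K' (?A \<union> acts E2) (?z (?A \<union> acts E2))) (start E) (start E')"
    using init acts_eq unfolding tracked_def region_init_def by auto
  moreover have "start F = c (start E, start E2)" "start F' = c' (start E', start E2)"
    using comp comp' by (auto simp: composes_def)
  ultimately show ?thesis
    using region_reach.init[of K' F] region_reach.init[of K' F']
    unfolding R_comp_def region_init_def comp_acts by auto
qed

end

section \<open>Precongruence for any composition satisfying \<open>composes\<close>\<close>

lemma weak_refines_composes:
  assumes E1: "is_apeca E1" and E1': "is_apeca E1'" and E2: "is_apeca E2" and ref: "E1 \<preceq>\<^sub>W E1'"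
    and comp: "composes c F E1 E2" and comp': "composes c' F' E1' E2"
  shows "F \<preceq>\<^sub>W F'"
proof -
  define K where "K x = max (ceil_of E1 x) (ceil_of E1' x)" for x
  define K' where "K' x = max (ceil_of F x) (ceil_of F' x)" for x
  have acts: "acts E1 = acts E1'"
    using ref by (simp add: weak_refines_def)
  obtain R where R: "weak_ref_rel (region_automaton K E1) (region_automaton K E1') R"
    "(region_init K E1, region_init K E1') \<in> R"
    using ref by (auto simp: weak_refines_def region_automaton_def K_def[abs_def] Let_def)
  \<comment> \<open>Composing does not lower the ceiling on either side, so the maxima compare as
    well.\<close>
  have "K x \<le> K' x" for x
    using ceil_of_le_composes[OF E1 E2 comp, of x] ceil_of_le_composes[OF E1' E2 comp', of x]
    by (auto simp: K_def K'_def le_max_iff_disj)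
  then interpret composed_refinement E1 E1' K K' R E2 c F c' F'
    using E1 E1' acts R comp comp' by unfold_locales (auto simp: K_def)
  have "sinit (region_automaton K' F) = region_init K' F"
    "sinit (region_automaton K' F') = region_init K' F'"
    by (simp_all add: region_automaton_def)
  then show ?thesis
    using weak_ref_rel_R_comp init_R_comp comp_acts
    unfolding weak_refines_def Let_def K'_def[abs_def] by auto
qed

theorem theorem7:
  fixes E1 :: "('l, 'a, 'p) apeca"
    and E1' :: "('m, 'a, 'p) apeca"
    and E2 :: "('n, 'a, 'p) apeca"
  assumes "is_apeca E1" and "is_apeca E1'" and "is_apeca E2"
    and "props E2 \<inter> props E1 = {}" and "props E2 \<inter> props E1' = {}"
    and "E1 \<preceq>\<^sub>W E1'"
  shows "(E1 \<parallel> E2) \<preceq>\<^sub>W (E1' \<parallel> E2) \<and> (E2 \<parallel> E1) \<preceq>\<^sub>W (E2 \<parallel> E1')"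
  using weak_refines_composes[OF assms(1-3,6) composes_par composes_par]
    weak_refines_composes[OF assms(1-3,6) composes_par_swap composes_par_swap] ..

end
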